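(* Let $1<p<\infty$, $\varepsilon>0$, and let $u$ be a smooth solution of $u_t=a_{ij}(\nabla u)u_{ij}$ in $Q_1$, where $a_{ij}(q)=\delta_{ij}+(p-2)\frac{q_iq_j}{|q|^2+\varepsilon^2}$. Then there exists a constant $C>0$ depending only on $n$ and $p$ (in particular independent of $\varepsilon$) such that $$\|\nabla u\|_{L^\infty(Q_{1/2})}\le C\big(\|u\|_{L^\infty(Q_1)}+\varepsilon\big).$$
   Context: $\nabla$ is the spatial gradient, $u_{ij}=\partial_{x_ix_j}u$, summation over repeated indices; $B_r$ is the ball of radius $r$ centered at $0$ in $\mathbb{R}^n$ and $Q_r=B_r\times(-r^2,0]$. *)

theory Defs
  imports "HOL-Analysis.Analysis"
begin

text \<open>k times continuously (Frechet) differentiable real-valued functions on a set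
  (intended for open sets): all iterated directional derivatives exist and are continuous.\<close>
fun Ck_on :: "nat \<Rightarrow> 'a::real_normed_vector set \<Rightarrow> ('a \<Rightarrow> real) \<Rightarrow> bool" where
  "Ck_on 0 S f = continuous_on S f"
| "Ck_on (Suc k) S f =
     (f differentiable_on S \<and> (\<forall>v. Ck_on k S (\<lambda>x. frechet_derivative f (at x) v)))"

definition smooth_on :: "'a::real_normed_vector set \<Rightarrow> ('a \<Rightarrow> real) \<Rightarrow> bool" where
  "smooth_on S f \<longleftrightarrow> (\<forall>k. Ck_on k S f)"

definition pgrad :: "('a::euclidean_space \<Rightarrow> real \<Rightarrow> real) \<Rightarrow> 'a \<Rightarrow> real \<Rightarrow> 'a" where
  "pgrad u x t = (\<Sum>i\<in>Basis. frechet_derivative (\<lambda>y. u y t) (at x) i *\<^sub>R i)"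

definition pd2 :: "('a::euclidean_space \<Rightarrow> real \<Rightarrow> real) \<Rightarrow> 'a \<Rightarrow> 'a \<Rightarrow> 'a \<Rightarrow> real \<Rightarrow> real" where
  "pd2 u i j x t =
     frechet_derivative (\<lambda>y. frechet_derivative (\<lambda>z. u z t) (at y) j) (at x) i"

definition ptime :: "('a \<Rightarrow> real \<Rightarrow> real) \<Rightarrow> 'a \<Rightarrow> real \<Rightarrow> real" where
  "ptime u x t = deriv (\<lambda>s. u x s) t"

definition acoef :: "real \<Rightarrow> real \<Rightarrow> 'a::euclidean_space \<Rightarrow> 'a \<Rightarrow> 'a \<Rightarrow> real" where
  "acoef p \<epsilon> q i j = (if i = j then 1 else 0) + (p - 2) * (q \<bullet> i) * (q \<bullet> j) / ((norm q)\<^sup>2 + \<epsilon>\<^sup>2)"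

end

theory Submission
  imports Defs
begin

text \<open>
  Bernstein's method. Put \<open>\<Phi> = \<eta>\<^sup>2 |\<nabla>u|\<^sup>2 + c u\<^sup>2\<close> with the cutoff
  \<open>\<eta> = (1/2 - |x|\<^sup>2)(t + 1/2)\<close>, which vanishes on the parabolic boundary of a cylinder containing
  \<open>Q\<^sub>1\<^sub>/\<^sub>2\<close>, and look at a maximum point with \<open>\<eta> > 0\<close> and \<open>\<nabla>u \<noteq> 0\<close>. There the unit vector
  \<open>e = \<nabla>u/|\<nabla>u|\<close> is frozen: since \<open>(\<partial>\<^sub>e u)\<^sup>2 \<le> |\<nabla>u|\<^sup>2\<close> with equality at the point,
  \<open>\<eta>\<^sup>2 v\<^sup>2 + c u\<^sup>2\<close> with \<open>v = \<partial>\<^sub>e u\<close> is maximal there too. Differentiating the equation in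
  direction \<open>e\<close> shows that \<open>v\<close> solves the frozen linear equation up to an error of size
  \<open>|\<nabla>v|\<^sup>2 / v\<close>, and the first order condition expresses \<open>\<eta>\<nabla>v\<close> through \<open>v \<nabla>\<eta>\<close> and \<open>c u e / \<eta>\<close>.
  The term \<open>-2 c a\<^sub>i\<^sub>j u\<^sub>i u\<^sub>j\<close> produced by \<open>c u\<^sup>2\<close> then absorbs everything of size \<open>v\<^sup>2\<close> if
  \<open>c\<close> is large, and leaves \<open>\<eta>\<^sup>2 v\<^sup>2 \<le> C (sup |u|)\<^sup>2\<close>, uniformly in \<open>\<epsilon>\<close>.
\<close>

subsection \<open>Directional derivatives\<close>

text \<open>The direction comes first so that \<open>ddir v\<close> is an operator on functions and
  can be iterated.\<close>

definition ddir :: "'a::real_normed_vector \<Rightarrow> ('a \<Rightarrow> real) \<Rightarrow> 'a \<Rightarrow> real" where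
  "ddir v f = (\<lambda>z. frechet_derivative f (at z) v)"

lemma DERIV_along_line:
  fixes f :: "'a::real_normed_vector \<Rightarrow> real"
  assumes "f differentiable at (z + r *\<^sub>R v)"
  shows "((\<lambda>h. f (z + h *\<^sub>R v)) has_real_derivative ddir v f (z + r *\<^sub>R v)) (at r)"
proof -
  let ?D = "frechet_derivative f (at (z + r *\<^sub>R v))"
  have D: "(f has_derivative ?D) (at (z + r *\<^sub>R v))"
    using assms frechet_derivative_works by blast
  have "((\<lambda>h. z + h *\<^sub>R v) has_derivative (\<lambda>h. h *\<^sub>R v)) (at r)"
    by (auto intro!: derivative_eq_intros)
  from has_derivative_compose[OF this D]
  have "((\<lambda>h. f (z + h *\<^sub>R v)) has_derivative (\<lambda>h. ?D (h *\<^sub>R v))) (at r)" .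
  moreover have "(\<lambda>h. ?D (h *\<^sub>R v)) = (*) (?D v)"
    using linear_frechet_derivative[OF assms] by (auto simp: linear_cmul)
  ultimately show ?thesis
    by (simp add: has_field_derivative_def ddir_def)
qed

lemma smooth_on_ddir:
  assumes "smooth_on S f"
  shows "smooth_on S (ddir v f)"
  unfolding smooth_on_def
proof
  fix k
  have "Ck_on (Suc k) S f"
    using assms unfolding smooth_on_def by (rule spec)
  then show "Ck_on k S (ddir v f)"
    by (simp add: ddir_def)
qed

lemma smooth_on_continuous_on:
  assumes "smooth_on S f"
  shows "continuous_on S f"
proof -
  have "Ck_on 0 S f"
    using assms unfolding smooth_on_def by (rule spec)
  then show ?thesis
    by simp
qed

lemma smooth_on_differentiable:
  assumes "smooth_on S f" "open S" "z \<in> S"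
  shows "f differentiable at z"
proof -
  have "Ck_on (Suc 0) S f"
    using assms(1) unfolding smooth_on_def by (rule spec)
  then show ?thesis
    using assms by (auto simp: differentiable_on_eq_differentiable_at)
qed

lemma ddir_add:
  assumes "f differentiable at z"
  shows "ddir (v + w) f z = ddir v f z + ddir w f z"
  unfolding ddir_def
  using linear_frechet_derivative[OF assms] by (rule linear_add)

lemma ddir_scale:
  assumes "f differentiable at z"
  shows "ddir (c *\<^sub>R v) f z = c * ddir v f z"
  unfolding ddir_def
  using linear_cmul[OF linear_frechet_derivative[OF assms]] by simp

text \<open>The mean value theorem is applied twice: first in the direction \<open>v\<close> to the
  increment of \<open>f\<close> over \<open>h *\<^sub>R w\<close>, then in the direction
  \<open>w\<close> to \<open>ddir v f\<close>.\<close>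

lemma second_difference_MVT:
  fixes f :: "'a::real_normed_vector \<Rightarrow> real"
  assumes S: "smooth_on S f" "open S" and h: "h > 0"
    and sub: "\<And>s r. 0 \<le> s \<Longrightarrow> s \<le> h \<Longrightarrow> 0 \<le> r \<Longrightarrow> r \<le> h \<Longrightarrow> z + s *\<^sub>R v + r *\<^sub>R w \<in> S"
  shows "\<exists>s r. 0 < s \<and> s < h \<and> 0 < r \<and> r < h \<and>
    f (z + h *\<^sub>R v + h *\<^sub>R w) - f (z + h *\<^sub>R v) - f (z + h *\<^sub>R w) + f z
      = h\<^sup>2 * ddir w (ddir v f) (z + s *\<^sub>R v + r *\<^sub>R w)"
proof -
  let ?g = "\<lambda>s. f ((z + h *\<^sub>R w) + s *\<^sub>R v) - f (z + s *\<^sub>R v)"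
  have g: "(?g has_real_derivative ddir v f ((z + h *\<^sub>R w) + s *\<^sub>R v) - ddir v f (z + s *\<^sub>R v)) (at s)"
    if "0 \<le> s" "s \<le> h" for s
  proof (intro DERIV_diff DERIV_along_line smooth_on_differentiable[OF S])
    show "z + h *\<^sub>R w + s *\<^sub>R v \<in> S"
      using sub[of s h] that h by (simp add: add_ac)
    show "z + s *\<^sub>R v \<in> S"
      using sub[of s 0] that h by simp
  qed
  obtain s where s: "0 < s" "s < h"
    and "?g h - ?g 0 = (h - 0) * (ddir v f ((z + h *\<^sub>R w) + s *\<^sub>R v) - ddir v f (z + s *\<^sub>R v))"
    using MVT2[OF h, of ?g, OF g] by auto
  then have 1: "f (z + h *\<^sub>R v + h *\<^sub>R w) - f (z + h *\<^sub>R v) - f (z + h *\<^sub>R w) + f z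
      = h * (ddir v f ((z + s *\<^sub>R v) + h *\<^sub>R w) - ddir v f ((z + s *\<^sub>R v) + 0 *\<^sub>R w))"
    by (simp add: add_ac)
  have "((\<lambda>r. ddir v f ((z + s *\<^sub>R v) + r *\<^sub>R w)) has_real_derivative
      ddir w (ddir v f) ((z + s *\<^sub>R v) + r *\<^sub>R w)) (at r)" if "0 \<le> r" "r \<le> h" for r
    using sub[of s r] that s
    by (intro DERIV_along_line smooth_on_differentiable[OF smooth_on_ddir[OF S(1)] S(2)]) auto
  then obtain r where r: "0 < r" "r < h"
    and "ddir v f ((z + s *\<^sub>R v) + h *\<^sub>R w) - ddir v f ((z + s *\<^sub>R v) + 0 *\<^sub>R w)
      = (h - 0) * ddir w (ddir v f) ((z + s *\<^sub>R v) + r *\<^sub>R w)"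
    using MVT2[OF h, of "\<lambda>r. ddir v f ((z + s *\<^sub>R v) + r *\<^sub>R w)"
        "\<lambda>r. ddir w (ddir v f) ((z + s *\<^sub>R v) + r *\<^sub>R w)"] by auto
  with 1 have "f (z + h *\<^sub>R v + h *\<^sub>R w) - f (z + h *\<^sub>R v) - f (z + h *\<^sub>R w) + f z
      = h\<^sup>2 * ddir w (ddir v f) (z + s *\<^sub>R v + r *\<^sub>R w)"
    by (simp only: power2_eq_square mult.assoc diff_0_right)
  with s r show ?thesis
    by blast
qed

text \<open>The second difference of \<open>f\<close> over the parallelogram spanned by
  \<open>h *\<^sub>R v\<close> and \<open>h *\<^sub>R w\<close> is symmetric in \<open>v\<close> and
  \<open>w\<close>, and it equals h^2 times a value of either mixed derivative close to
  \<open>z\<close>. Continuity of both mixed derivatives then forces equality at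
  \<open>z\<close>.\<close>

lemma ddir_commute:
  fixes f :: "'a::real_normed_vector \<Rightarrow> real"
  assumes S: "smooth_on S f" "open S" "z \<in> S"
  shows "ddir v (ddir w f) z = ddir w (ddir v f) z"
proof (rule ccontr)
  let ?P = "ddir v (ddir w f)" and ?R = "ddir w (ddir v f)"
  assume "?P z \<noteq> ?R z"
  \<comment> \<open>Half the gap: two equal values within \<open>e\<close> of \<open>?P z\<close>
    and \<open>?R z\<close> respectively give a contradiction.\<close>
  define e where "e = \<bar>?P z - ?R z\<bar> / 2"
  have e: "e > 0"
    using \<open>?P z \<noteq> ?R z\<close> by (simp add: e_def)
  have "isCont (ddir a (ddir b f)) z" for a b
    using smooth_on_continuous_on[OF smooth_on_ddir[OF smooth_on_ddir[OF S(1)]]] S(2,3)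
    by (simp add: continuous_on_eq_continuous_at)
  from this[of v w] this[of w v] have "(?P \<longlongrightarrow> ?P z) (nhds z)" "(?R \<longlongrightarrow> ?R z) (nhds z)"
    by (simp_all add: isCont_def tendsto_at_iff_tendsto_nhds)
  then have "\<forall>\<^sub>F y in nhds z. dist (?P y) (?P z) < e \<and> dist (?R y) (?R z) < e \<and> y \<in> S"
    using e eventually_nhds_in_open[OF S(2,3)] by (intro eventually_conj tendstoD)
  then have "\<forall>\<^sub>F y in nhds z. \<bar>?P y - ?P z\<bar> < e \<and> \<bar>?R y - ?R z\<bar> < e \<and> y \<in> S"
    by (simp add: dist_real_def)
  then obtain d where d: "d > 0"
    "\<And>y. dist y z < d \<Longrightarrow> \<bar>?P y - ?P z\<bar> < e \<and> \<bar>?R y - ?R z\<bar> < e \<and> y \<in> S"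
    unfolding eventually_nhds_metric by auto
  \<comment> \<open>The parallelogram stays within distance \<open>d\<close> of \<open>z\<close>;
    the summand 1 keeps the denominator positive when \<open>v\<close> and \<open>w\<close> both
    vanish.\<close>
  define h where "h = d / (norm v + norm w + 1)"
  have pos: "norm v + norm w + 1 > 0"
    by (smt (verit) norm_ge_zero)
  have h: "h > 0" and hd: "h * (norm v + norm w) < d"
    using d(1) pos by (auto simp: h_def field_simps)
  have near: "dist (z + s *\<^sub>R v + r *\<^sub>R w) z < d"
    if "0 \<le> s" "s \<le> h" "0 \<le> r" "r \<le> h" for s r
  proof -
    have "dist (z + s *\<^sub>R v + r *\<^sub>R w) z = norm (s *\<^sub>R v + r *\<^sub>R w)"
      by (simp add: dist_norm add.assoc)
    also have "\<dots> \<le> s * norm v + r * norm w"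
      using norm_triangle_ineq[of "s *\<^sub>R v" "r *\<^sub>R w"] that by simp
    also have "\<dots> \<le> h * norm v + h * norm w"
      using that by (intro add_mono mult_right_mono) auto
    finally show ?thesis
      using hd by (simp add: distrib_left)
  qed
  obtain s r where sr: "0 < s" "s < h" "0 < r" "r < h"
    and 1: "f (z + h *\<^sub>R v + h *\<^sub>R w) - f (z + h *\<^sub>R v) - f (z + h *\<^sub>R w) + f z
      = h\<^sup>2 * ?R (z + s *\<^sub>R v + r *\<^sub>R w)"
    using second_difference_MVT[OF S(1,2) h, of z v w, OF d(2)[OF near, THEN conjunct2, THEN conjunct2]]
    by blast
  have "z + s *\<^sub>R w + r *\<^sub>R v \<in> S" if "0 \<le> s" "s \<le> h" "0 \<le> r" "r \<le> h" for s r
    using d(2)[OF near[of r s], THEN conjunct2, THEN conjunct2] that by (simp add: add_ac)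
  then obtain s' r' where sr': "0 < s'" "s' < h" "0 < r'" "r' < h"
    and 2: "f (z + h *\<^sub>R w + h *\<^sub>R v) - f (z + h *\<^sub>R w) - f (z + h *\<^sub>R v) + f z
      = h\<^sup>2 * ?P (z + s' *\<^sub>R w + r' *\<^sub>R v)"
    using second_difference_MVT[OF S(1,2) h, of z w v] by force
  have "h\<^sup>2 * ?R (z + s *\<^sub>R v + r *\<^sub>R w) = h\<^sup>2 * ?P (z + s' *\<^sub>R w + r' *\<^sub>R v)"
    using 1 2 by (simp add: algebra_simps)
  then have "?R (z + s *\<^sub>R v + r *\<^sub>R w) = ?P (z + r' *\<^sub>R v + s' *\<^sub>R w)"
    using h by (simp add: add_ac)
  moreover have "\<bar>?R (z + s *\<^sub>R v + r *\<^sub>R w) - ?R z\<bar> < e"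
    using d(2)[OF near[of s r]] sr by simp
  moreover have "\<bar>?P (z + r' *\<^sub>R v + s' *\<^sub>R w) - ?P z\<bar> < e"
    using d(2)[OF near[of r' s']] sr' by simp
  ultimately show False
    unfolding e_def by (smt (verit) field_sum_of_halves)
qed

subsection \<open>Maximum conditions\<close>

text \<open>If \<open>l\<close> were positive, \<open>f'\<close> would be positive just to the right
  of its zero at 0, and the mean value theorem would make \<open>f\<close> exceed \<open>f 0\<close>
  there.\<close>

lemma second_derivative_le_0_at_local_max:
  fixes f :: "real \<Rightarrow> real"
  assumes d: "d > 0"
    and max: "\<And>h. \<bar>h\<bar> < d \<Longrightarrow> f h \<le> f 0"
    and f': "\<And>h. \<bar>h\<bar> < d \<Longrightarrow> (f has_real_derivative f' h) (at h)"
    and f'': "(f' has_real_derivative l) (at 0)"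
  shows "f' 0 = 0" "l \<le> 0"
proof -
  show f'0: "f' 0 = 0"
    using DERIV_local_max[OF f'[of 0] d] max d by simp
  show "l \<le> 0"
  proof (rule ccontr)
    assume "\<not> l \<le> 0"
    then obtain d' where d': "d' > 0" "\<And>h. 0 < h \<Longrightarrow> h < d' \<Longrightarrow> f' 0 < f' (0 + h)"
      using DERIV_pos_inc_right[OF f''] by (meson not_le)
    define k where "k = min d d' / 2"
    have k: "0 < k" "k < d" "k < d'"
      using d d' by (auto simp: k_def)
    obtain y where "0 < y" "y < k" "f k - f 0 = (k - 0) * f' y"
      using MVT2[of 0 k f f'] f' k by force
    then have "f k - f 0 > 0"
      using d'(2)[of y] k f'0 by simp
    then show False
      using max[of k] k by simp
  qed
qed

text \<open>\<open>I + \<beta> e \<otimes> e\<close> is the square of \<open>I + c e \<otimes> e\<close>, so its trace against \<open>B\<close> is the sum of the values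
  of \<open>B\<close> on the diagonal at the vectors \<open>i + c (e \<bullet> i) e\<close>.\<close>

lemma trace_rank_one_perturbation:
  fixes B :: "'a::euclidean_space \<Rightarrow> 'a \<Rightarrow> real"
  assumes l: "\<And>y. linear (\<lambda>x. B x y)" and r: "\<And>x. linear (B x)"
    and nonpos: "\<And>x. B x x \<le> 0" and e: "norm e = 1" and \<beta>: "\<beta> > -1"
  shows "(\<Sum>i\<in>Basis. B i i) + \<beta> * B e e \<le> 0"
proof -
  \<comment> \<open>The root of (1 + c)^2 = 1 + \<beta>, which is real because \<beta> > -1.\<close>
  define c where "c = sqrt (1 + \<beta>) - 1"
  have c: "2 * c + c\<^sup>2 = \<beta>"
    using \<beta> by (simp add: c_def power2_eq_square algebra_simps)
  have B: "B (x + c' *\<^sub>R y) (z + c' *\<^sub>R w) = B x z + c' * B x w + c' * B y z + c' * c' * B y w"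
    for x y z w c'
    using linear_add[OF l] linear_add[OF r] linear_cmul[OF l] linear_cmul[OF r]
    by (simp add: algebra_simps)
  have e_sum: "e = (\<Sum>i\<in>Basis. (e \<bullet> i) *\<^sub>R i)"
    by (simp add: euclidean_representation)
  have 1: "(\<Sum>i\<in>Basis. (e \<bullet> i) * B i e) = B e e"
    using linear_sum[OF l[of e], of "\<lambda>i. (e \<bullet> i) *\<^sub>R i" Basis] e_sum
    by (simp add: linear_cmul[OF l])
  have 2: "(\<Sum>i\<in>Basis. (e \<bullet> i) * B e i) = B e e"
    using linear_sum[OF r[of e], of "\<lambda>i. (e \<bullet> i) *\<^sub>R i" Basis] e_sum
    by (simp add: linear_cmul[OF r])
  have 3: "(\<Sum>i\<in>Basis. (e \<bullet> i) * (e \<bullet> i)) = 1"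
    using e by (simp add: norm_eq_1 euclidean_inner[of e e])
  have "B (i + (c * (e \<bullet> i)) *\<^sub>R e) (i + (c * (e \<bullet> i)) *\<^sub>R e) =
     B i i + c * ((e \<bullet> i) * B i e) + c * ((e \<bullet> i) * B e i) + c\<^sup>2 * B e e * ((e \<bullet> i) * (e \<bullet> i))" for i
    by (simp only: B) (simp add: power2_eq_square)
  then have "(\<Sum>i\<in>Basis. B (i + (c * (e \<bullet> i)) *\<^sub>R e) (i + (c * (e \<bullet> i)) *\<^sub>R e))
    = (\<Sum>i\<in>Basis. B i i) + c * B e e + c * B e e + c\<^sup>2 * B e e * 1"
    by (simp only: sum.distrib flip: sum_distrib_left) (simp only: 1 2 3)
  also have "\<dots> = (\<Sum>i\<in>Basis. B i i) + \<beta> * B e e"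
    by (simp flip: c add: algebra_simps)
  finally show ?thesis
    using sum_nonpos[of Basis "\<lambda>i. B (i + (c * (e \<bullet> i)) *\<^sub>R e) (i + (c * (e \<bullet> i)) *\<^sub>R e)"] nonpos
    by simp
qed

subsection \<open>Differentiating the equation\<close>

lemma DERIV_along_line_0:
  fixes f :: "'a::real_normed_vector \<Rightarrow> real"
  assumes "f differentiable at z"
  shows "((\<lambda>h. f (z + h *\<^sub>R v)) has_real_derivative ddir v f z) (at 0)"
  using DERIV_along_line[of f z 0 v] assms by simp

lemma ddir_cong_open:
  assumes "f differentiable at z" "open S" "z \<in> S" "\<And>y. y \<in> S \<Longrightarrow> f y = g y"
  shows "ddir v f z = ddir v g z"
  unfolding ddir_def using frechet_derivative_transform_within_open[OF assms] by simp

text \<open>Space and time derivatives are both directional derivatives of one function on the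
  product space, so \<open>ddir_commute\<close> exchanges them as well.\<close>

abbreviation sdir :: "'a::euclidean_space \<Rightarrow> ('a \<times> real \<Rightarrow> real) \<Rightarrow> 'a \<times> real \<Rightarrow> real" where
  "sdir \<xi> \<equiv> ddir (\<xi>, 0)"

abbreviation tdir :: "('a::euclidean_space \<times> real \<Rightarrow> real) \<Rightarrow> 'a \<times> real \<Rightarrow> real" where
  "tdir \<equiv> ddir (0, 1)"

lemma linear_sdir:
  assumes "f differentiable at z"
  shows "linear (\<lambda>\<xi>. sdir \<xi> f z)"
proof (rule linearI)
  show "sdir (x + y) f z = sdir x f z + sdir y f z" for x y
    using ddir_add[OF assms, of "(x, 0)" "(y, 0)"] by simp
  show "sdir (c *\<^sub>R x) f z = c *\<^sub>R sdir x f z" for c x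
    using ddir_scale[OF assms, of c "(x, 0)"] by simp
qed

lemma sdir_expansion:
  assumes "f differentiable at z"
  shows "(\<Sum>i\<in>Basis. (e \<bullet> i) * sdir i f z) = sdir e f z"
proof -
  note l = linear_sdir[OF assms]
  have "sdir (\<Sum>i\<in>Basis. (e \<bullet> i) *\<^sub>R i) f z = (\<Sum>i\<in>Basis. (e \<bullet> i) * sdir i f z)"
    by (simp add: linear_sum[OF l] linear_cmul[OF l])
  then show ?thesis
    by (simp add: euclidean_representation)
qed

lemma sdir_eq_inner:
  assumes "f differentiable at z"
  shows "sdir \<xi> f z = (\<Sum>i\<in>Basis. sdir i f z *\<^sub>R i) \<bullet> \<xi>"
  using sdir_expansion[OF assms, of \<xi>]
  by (simp add: inner_sum_left inner_commute[of \<xi>] mult.commute)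

section \<open>Comparison with derivatives of slices in space and in time\<close>

lemma has_derivative_slice:
  assumes "G differentiable at (x, t)"
  shows "((\<lambda>y. G (y, t)) has_derivative (\<lambda>h. sdir h G (x, t))) (at x)"
proof -
  have "((\<lambda>y. (y, t)) has_derivative (\<lambda>h. (h, 0))) (at x)"
    by (auto intro!: derivative_eq_intros)
  from has_derivative_compose[OF this] assms show ?thesis
    unfolding ddir_def frechet_derivative_works by blast
qed

lemma frechet_derivative_slice:
  assumes "G differentiable at (x, t)"
  shows "frechet_derivative (\<lambda>y. G (y, t)) (at x) h = sdir h G (x, t)"
  using frechet_derivative_at[OF has_derivative_slice[OF assms]] by metis

lemma deriv_slice:
  assumes "G differentiable at (x, t)"
  shows "deriv (\<lambda>s. G (x, s)) t = tdir G (x, t)"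
proof -
  have "((\<lambda>s. G ((x, 0) + s *\<^sub>R (0, 1))) has_real_derivative tdir G ((x, 0) + t *\<^sub>R (0, 1))) (at t)"
    using assms by (intro DERIV_along_line) simp
  then show ?thesis
    by (intro DERIV_imp_deriv) simp
qed

lemma sdir_eq_pgrad:
  assumes "(\<lambda>z. u (fst z) (snd z)) differentiable at (x, t)"
  shows "sdir \<xi> (\<lambda>z. u (fst z) (snd z)) (x, t) = pgrad u x t \<bullet> \<xi>"
  unfolding sdir_eq_inner[OF assms, of \<xi>]
  using frechet_derivative_slice[OF assms] by (simp add: pgrad_def)

text \<open>The inner slice derivative agrees with \<open>sdir j\<close> on all of the open set
  \<open>A\<close>, not only at \<open>x\<close>, and may therefore be replaced under the outer
  derivative.\<close>

lemma pd2_eq_sdir: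
  fixes u :: "'a::euclidean_space \<Rightarrow> real \<Rightarrow> real"
  assumes S: "smooth_on (A \<times> T) (\<lambda>z. u (fst z) (snd z))" "open A" "open T" and x: "x \<in> A" "t \<in> T"
  shows "pd2 u i j x t = sdir i (sdir j (\<lambda>z. u (fst z) (snd z))) (x, t)"
proof -
  let ?F = "\<lambda>z. u (fst z) (snd z)"
  have o: "open (A \<times> T)"
    using S by (simp add: open_Times)
  have G: "sdir j ?F differentiable at (x, t)"
    using smooth_on_differentiable[OF smooth_on_ddir[OF S(1)] o] x by simp
  have eq: "sdir j ?F (y, t) = frechet_derivative (\<lambda>z. u z t) (at y) j" if "y \<in> A" for y
    using frechet_derivative_slice[OF smooth_on_differentiable[OF S(1) o], of y t j] that x
    by simp
  have "(\<lambda>y. sdir j ?F (y, t)) differentiable at x"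
    using has_derivative_slice[OF G] unfolding differentiable_def by blast
  from frechet_derivative_transform_within_open[OF this S(2) x(1) eq]
  show ?thesis
    using frechet_derivative_slice[OF G] by (simp add: pd2_def)
qed

section \<open>The equation in terms of directional derivatives\<close>

lemma sum_acoef:
  fixes q :: "'a::euclidean_space"
  shows "(\<Sum>i\<in>Basis. \<Sum>j\<in>Basis. acoef p \<epsilon> q i j * H i j) =
    (\<Sum>i\<in>Basis. H i i) +
    (p - 2) / ((norm q)\<^sup>2 + \<epsilon>\<^sup>2) * (\<Sum>i\<in>Basis. \<Sum>j\<in>Basis. (q \<bullet> i) * (q \<bullet> j) * H i j)"
proof -
  have "acoef p \<epsilon> q i j * H i j = (if i = j then H i j else 0) +
      (p - 2) / ((norm q)\<^sup>2 + \<epsilon>\<^sup>2) * ((q \<bullet> i) * (q \<bullet> j) * H i j)" for i j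
    by (simp add: acoef_def algebra_simps)
  then show ?thesis
    by (simp add: sum.distrib sum_distrib_left)
qed

definition p_heat_on :: "real \<Rightarrow> real \<Rightarrow> ('a::euclidean_space \<times> real) set \<Rightarrow> ('a \<times> real \<Rightarrow> real) \<Rightarrow> bool" where
  "p_heat_on p \<epsilon> S F \<longleftrightarrow> (\<forall>z\<in>S. tdir F z = (\<Sum>i\<in>Basis. sdir i (sdir i F) z) +
    (p - 2) / ((\<Sum>i\<in>Basis. (sdir i F z)\<^sup>2) + \<epsilon>\<^sup>2) *
    (\<Sum>i\<in>Basis. \<Sum>j\<in>Basis. sdir i F z * sdir j F z * sdir i (sdir j F) z))"

text \<open>Commuting the derivatives moves the direction \<open>j\<close> outside, where linearity
  in the direction holds at the single point \<open>z\<close>.\<close>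

lemma sdir_sdir_expansion:
  assumes "smooth_on S f" "open S" "z \<in> S"
  shows "(\<Sum>j\<in>Basis. (e \<bullet> j) * sdir \<xi> (sdir j f) z) = sdir \<xi> (sdir e f) z"
  using sdir_expansion[OF smooth_on_differentiable[OF smooth_on_ddir[OF assms(1)] assms(2,3)], of e "(\<xi>, 0)"]
  by (simp add: ddir_commute[OF assms, of "(\<xi>, 0)"])

lemma hessian_expansion:
  assumes "smooth_on S f" "open S" "z \<in> S"
  shows "(\<Sum>i\<in>Basis. \<Sum>j\<in>Basis. (e \<bullet> i) * (e \<bullet> j) * sdir i (sdir j f) z) = sdir e (sdir e f) z"
proof -
  have "(\<Sum>i\<in>Basis. \<Sum>j\<in>Basis. (e \<bullet> i) * (e \<bullet> j) * sdir i (sdir j f) z)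
      = (\<Sum>i\<in>Basis. (e \<bullet> i) * sdir i (sdir e f) z)"
    using sdir_sdir_expansion[OF assms] by (simp add: mult.assoc flip: sum_distrib_left)
  also have "\<dots> = sdir e (sdir e f) z"
    by (rule sdir_expansion[OF smooth_on_differentiable[OF smooth_on_ddir[OF assms(1)] assms(2,3)]])
  finally show ?thesis .
qed

lemma sum_inner_Basis_squares:
  fixes e :: "'a::euclidean_space"
  shows "(\<Sum>i\<in>Basis. (e \<bullet> i)\<^sup>2) = (norm e)\<^sup>2"
  by (simp only: power2_norm_eq_inner euclidean_inner[of e e]) (simp add: power2_eq_square)

text \<open>Where the spatial gradient is \<open>v *\<^sub>R e\<close>, the coefficient matrix is
  the identity plus a multiple of the projection onto \<open>e\<close>. The second claim is the
  derivative of the equation along the fixed direction \<open>e\<close>; its last two terms come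
  from differentiating the coefficients, namely the gradient factors in the numerator
  \<open>N\<close> and the denominator \<open>s\<close>.\<close>

lemma p_heat_at_radial_gradient:
  assumes F: "smooth_on S F" "open S" "z \<in> S" and eq: "p_heat_on p \<epsilon> S F" and \<epsilon>: "\<epsilon> > 0"
    and e: "norm e = 1" and grad: "\<And>i. i \<in> Basis \<Longrightarrow> sdir i F z = v * (e \<bullet> i)"
  shows "tdir F z = (\<Sum>i\<in>Basis. sdir i (sdir i F) z) +
    (p - 2) * v\<^sup>2 / (v\<^sup>2 + \<epsilon>\<^sup>2) * sdir e (sdir e F) z"
    and "tdir (sdir e F) z = (\<Sum>i\<in>Basis. sdir i (sdir i (sdir e F)) z) +
    (p - 2) * v\<^sup>2 / (v\<^sup>2 + \<epsilon>\<^sup>2) * sdir e (sdir e (sdir e F)) z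
    + 2 * (p - 2) * v / (v\<^sup>2 + \<epsilon>\<^sup>2) * (\<Sum>i\<in>Basis. (sdir i (sdir e F) z)\<^sup>2)
    - 2 * (p - 2) * v ^ 3 / (v\<^sup>2 + \<epsilon>\<^sup>2)\<^sup>2 * (sdir e (sdir e F) z)\<^sup>2"
proof -
  let ?V = "sdir e F"
  define H where "H i j = sdir i (sdir j F) z" for i j
  define W where "W i = sdir i ?V z" for i
  define s where "s y = (\<Sum>i\<in>Basis. (sdir i F y)\<^sup>2) + \<epsilon>\<^sup>2" for y
  define N where "N y = (\<Sum>i\<in>Basis. \<Sum>j\<in>Basis. sdir i F y * sdir j F y * sdir i (sdir j F) y)" for y
  \<comment> \<open>At h = 0 the multiple of \<open>(e, 0)\<close> simplifies componentwise to
    \<open>(0, 0)\<close>, which has to be folded back to 0.\<close>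
  note [simp] = zero_prod_def[symmetric]
  note F1 = smooth_on_ddir[OF F(1)]
  note F2 = smooth_on_ddir[OF F1]
  note diff0 = smooth_on_differentiable[OF F] and diff1 = smooth_on_differentiable[OF F1 F(2,3)]
    and diff2 = smooth_on_differentiable[OF F2 F(2,3)]
  have We: "sdir e (sdir i F) z = W i" for i
    unfolding W_def by (rule ddir_commute[OF F])
  have HW: "(\<Sum>j\<in>Basis. (e \<bullet> j) * H i j) = W i" for i
    unfolding H_def W_def by (rule sdir_sdir_expansion[OF F])
  have HW': "(\<Sum>i\<in>Basis. (e \<bullet> i) * H i j) = W j" for j
    using HW[of j] ddir_commute[OF F] by (simp add: H_def)
  have eW: "(\<Sum>i\<in>Basis. (e \<bullet> i) * W i) = W e"
    unfolding W_def by (rule sdir_expansion[OF diff1])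
  have s: "s z = v\<^sup>2 + \<epsilon>\<^sup>2"
    using sum_inner_Basis_squares[of e] e
    by (simp add: s_def grad power_mult_distrib flip: sum_distrib_left)
  have "s z > 0"
    using \<epsilon> unfolding s by (simp add: add_nonneg_pos)
  have "N z = v\<^sup>2 * (\<Sum>i\<in>Basis. \<Sum>j\<in>Basis. (e \<bullet> i) * (e \<bullet> j) * H i j)"
    by (simp add: N_def H_def grad power2_eq_square sum_distrib_left mult_ac)
  then have N: "N z = v\<^sup>2 * W e"
    using hessian_expansion[OF F, of e] by (simp add: H_def W_def)
  have pde: "tdir F y = (\<Sum>i\<in>Basis. sdir i (sdir i F) y) + (p - 2) / s y * N y" if "y \<in> S" for y
    using eq that by (simp add: p_heat_on_def s_def N_def)
  show "tdir F z = (\<Sum>i\<in>Basis. sdir i (sdir i F) z) +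
    (p - 2) * v\<^sup>2 / (v\<^sup>2 + \<epsilon>\<^sup>2) * sdir e (sdir e F) z"
    using pde[OF F(3)] by (simp add: s N W_def)

  let ?l = "\<lambda>h. z + h *\<^sub>R (e, 0)"
  have D1: "((\<lambda>h. sdir i F (?l h)) has_real_derivative W i) (at 0)" for i
    using DERIV_along_line_0[OF diff1] We by metis
  have D2: "((\<lambda>h. sdir i (sdir j F) (?l h)) has_real_derivative sdir i (sdir j ?V) z) (at 0)" for i j
  proof -
    have "sdir e (sdir i (sdir j F)) z = sdir i (sdir e (sdir j F)) z"
      by (rule ddir_commute[OF F1 F(2,3)])
    \<comment> \<open>This exchange takes place under an outer derivative, so it is used on the
      whole open set \<open>S\<close>.\<close>
    also have "\<dots> = sdir i (sdir j ?V) z"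
      by (rule ddir_cong_open[OF diff2 F(2,3)]) (rule ddir_commute[OF F(1,2)])
    finally show ?thesis
      using DERIV_along_line_0[OF diff2] by metis
  qed
  have sq: "((\<lambda>h. (sdir i F (?l h))\<^sup>2) has_real_derivative 2 * sdir i F z * W i) (at 0)" for i
    using DERIV_power[OF D1[of i], of 2] by (simp add: mult_ac)
  have "((\<lambda>h. s (?l h)) has_real_derivative (\<Sum>i\<in>Basis. 2 * sdir i F z * W i) + 0) (at 0)"
    unfolding s_def using sq by (intro DERIV_add DERIV_sum DERIV_const)
  moreover have "(\<Sum>i\<in>Basis. 2 * sdir i F z * W i) + 0 = 2 * v * (\<Sum>i\<in>Basis. (e \<bullet> i) * W i)"
    by (simp add: grad sum_distrib_left mult_ac)
  ultimately have Ds: "((\<lambda>h. s (?l h)) has_real_derivative 2 * v * W e) (at 0)"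
    by (simp add: eW)
  \<comment> \<open>Product rule: a derivative falling on either gradient factor contracts the
    Hessian with \<open>e\<close> and gives v |W|^2, one falling on the Hessian gives v^2 times the
    second derivative of \<open>?V\<close> along \<open>e\<close>.\<close>
  have "((\<lambda>h. N (?l h)) has_real_derivative (\<Sum>i\<in>Basis. \<Sum>j\<in>Basis.
      (W i * sdir j F z + W j * sdir i F z) * H i j
      + sdir i (sdir j ?V) z * (sdir i F z * sdir j F z))) (at 0)"
    unfolding N_def H_def
    using DERIV_mult[OF DERIV_mult[OF D1 D1] D2] by (intro DERIV_sum) simp
  also have "(\<Sum>i\<in>Basis. \<Sum>j\<in>Basis. (W i * sdir j F z + W j * sdir i F z) * H i j
      + sdir i (sdir j ?V) z * (sdir i F z * sdir j F z))
    = v * (\<Sum>i\<in>Basis. \<Sum>j\<in>Basis. W i * ((e \<bullet> j) * H i j))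
      + v * (\<Sum>i\<in>Basis. \<Sum>j\<in>Basis. W j * ((e \<bullet> i) * H i j))
      + v\<^sup>2 * (\<Sum>i\<in>Basis. \<Sum>j\<in>Basis. (e \<bullet> i) * (e \<bullet> j) * sdir i (sdir j ?V) z)"
    by (simp add: grad sum_distrib_left power2_eq_square algebra_simps flip: sum.distrib)
  also have "(\<Sum>i\<in>Basis. \<Sum>j\<in>Basis. W i * ((e \<bullet> j) * H i j)) = (\<Sum>i\<in>Basis. (W i)\<^sup>2)"
    by (simp add: HW power2_eq_square flip: sum_distrib_left)
  also have "(\<Sum>i\<in>Basis. \<Sum>j\<in>Basis. W j * ((e \<bullet> i) * H i j)) = (\<Sum>i\<in>Basis. (W i)\<^sup>2)"
    by (subst sum.swap) (simp add: HW' power2_eq_square flip: sum_distrib_left)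
  also have "(\<Sum>i\<in>Basis. \<Sum>j\<in>Basis. (e \<bullet> i) * (e \<bullet> j) * sdir i (sdir j ?V) z) = sdir e (sdir e ?V) z"
    by (rule hessian_expansion[OF F1 F(2,3)])
  finally have DN: "((\<lambda>h. N (?l h)) has_real_derivative
      2 * v * (\<Sum>i\<in>Basis. (W i)\<^sup>2) + v\<^sup>2 * sdir e (sdir e ?V) z) (at 0)"
    by (simp add: mult.assoc)
  have D: "((\<lambda>h. (\<Sum>i\<in>Basis. sdir i (sdir i F) (?l h)) + (p - 2) * (N (?l h) / s (?l h)))
      has_real_derivative (\<Sum>i\<in>Basis. sdir i (sdir i ?V) z) + (p - 2) *
        (((2 * v * (\<Sum>i\<in>Basis. (W i)\<^sup>2) + v\<^sup>2 * sdir e (sdir e ?V) z) * s z - N z * (2 * v * W e))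
          / (s z * s z))) (at 0)"
    using DERIV_add[OF DERIV_sum[of Basis, OF D2] DERIV_cmult[OF DERIV_divide[OF DN Ds]]] \<open>s z > 0\<close>
    by simp
  \<comment> \<open>The equation holds along the line for all small \<open>h\<close>, so its two
    sides have the same derivative at 0.\<close>
  have ev: "\<forall>\<^sub>F h in nhds 0. tdir F (?l h) =
      (\<Sum>i\<in>Basis. sdir i (sdir i F) (?l h)) + (p - 2) * (N (?l h) / s (?l h))"
  proof -
    have "open (?l -` S)"
      by (intro open_vimage F(2) continuous_intros)
    then have "\<forall>\<^sub>F h in nhds 0. h \<in> ?l -` S"
      using F(3) by (intro eventually_nhds_in_open) auto
    then show ?thesis
      by eventually_elim (simp add: pde)
  qed
  have "((\<lambda>h. tdir F (?l h)) has_real_derivative (\<Sum>i\<in>Basis. sdir i (sdir i ?V) z) + (p - 2) *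
        (((2 * v * (\<Sum>i\<in>Basis. (W i)\<^sup>2) + v\<^sup>2 * sdir e (sdir e ?V) z) * s z - N z * (2 * v * W e))
          / (s z * s z))) (at 0)"
    by (rule iffD2[OF DERIV_cong_ev[OF refl ev refl] D])
  then have "sdir e (tdir F) z = (\<Sum>i\<in>Basis. sdir i (sdir i ?V) z) + (p - 2) *
        (((2 * v * (\<Sum>i\<in>Basis. (W i)\<^sup>2) + v\<^sup>2 * sdir e (sdir e ?V) z) * s z - N z * (2 * v * W e))
          / (s z * s z))"
    using DERIV_unique DERIV_along_line_0[OF diff1] by blast
  moreover have "sdir e (tdir F) z = tdir ?V z"
    by (rule ddir_commute[OF F])
  ultimately have "tdir ?V z = (\<Sum>i\<in>Basis. sdir i (sdir i ?V) z) + (p - 2) *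
        (((2 * v * (\<Sum>i\<in>Basis. (W i)\<^sup>2) + v\<^sup>2 * sdir e (sdir e ?V) z) * s z - v\<^sup>2 * W e * (2 * v * W e))
          / (s z * s z))"
    by (simp add: N)
  also have "\<dots> = (\<Sum>i\<in>Basis. sdir i (sdir i ?V) z) +
    (p - 2) * v\<^sup>2 / s z * sdir e (sdir e ?V) z + 2 * (p - 2) * v / s z * (\<Sum>i\<in>Basis. (W i)\<^sup>2)
    - 2 * (p - 2) * v ^ 3 / (s z)\<^sup>2 * (W e)\<^sup>2"
    using \<open>s z > 0\<close> by (simp add: field_simps power2_eq_square power3_eq_cube)
  finally show "tdir ?V z = (\<Sum>i\<in>Basis. sdir i (sdir i ?V) z) +
    (p - 2) * v\<^sup>2 / (v\<^sup>2 + \<epsilon>\<^sup>2) * sdir e (sdir e ?V) z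
    + 2 * (p - 2) * v / (v\<^sup>2 + \<epsilon>\<^sup>2) * (\<Sum>i\<in>Basis. (sdir i ?V z)\<^sup>2)
    - 2 * (p - 2) * v ^ 3 / (v\<^sup>2 + \<epsilon>\<^sup>2)\<^sup>2 * (sdir e ?V z)\<^sup>2"
    by (simp add: s W_def)
qed

subsection \<open>The inequality at a maximum point\<close>

text \<open>The form has the eigenvalue 1 + \<beta> along \<open>e\<close> and 1 on the orthogonal
  complement; Cauchy-Schwarz replaces the decomposition.\<close>

lemma rank_one_form_bounds:
  fixes y e :: "'a::real_inner"
  assumes "norm e = 1" "\<beta> > -1"
  shows "0 \<le> y \<bullet> y + \<beta> * (y \<bullet> e)\<^sup>2" "y \<bullet> y + \<beta> * (y \<bullet> e)\<^sup>2 \<le> (1 + \<bar>\<beta>\<bar>) * (y \<bullet> y)"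
proof -
  have cs: "(y \<bullet> e)\<^sup>2 \<le> y \<bullet> y"
    using Cauchy_Schwarz_ineq[of y e] assms(1) by (simp add: norm_eq_1)
  have "(y \<bullet> e)\<^sup>2 + \<beta> * (y \<bullet> e)\<^sup>2 = (1 + \<beta>) * (y \<bullet> e)\<^sup>2"
    by (simp add: algebra_simps)
  also have "\<dots> \<ge> 0"
    using assms(2) by simp
  finally show "0 \<le> y \<bullet> y + \<beta> * (y \<bullet> e)\<^sup>2"
    using cs by simp
  have "\<beta> * (y \<bullet> e)\<^sup>2 \<le> \<bar>\<beta>\<bar> * (y \<bullet> y)"
    using cs by (intro mult_mono) auto
  then show "y \<bullet> y + \<beta> * (y \<bullet> e)\<^sup>2 \<le> (1 + \<bar>\<beta>\<bar>) * (y \<bullet> y)"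
    by (simp add: algebra_simps)
qed

text \<open>Meaning of the variables: \<open>\<eta>' = \<partial>\<^sub>t \<eta>\<close>, \<open>g = \<nabla>\<eta>\<close>, \<open>\<tau> = t + 1/2\<close> (so \<open>\<partial>\<^sub>i\<^sub>j \<eta> = -2 \<tau> \<delta>\<^sub>i\<^sub>j\<close>), \<open>w = \<nabla>v\<close>;
  \<open>SV\<close>, \<open>Ve\<close>, \<open>Vt\<close> are \<open>\<Delta>v\<close>, \<open>\<partial>\<^sub>e\<^sub>e v\<close>, \<open>\<partial>\<^sub>t v\<close>, and \<open>SF\<close>, \<open>Fe\<close>, \<open>Ft\<close> the same for \<open>u\<close>, while \<open>n\<close> is
  the dimension and \<open>b = p - 2\<close>.\<close>

lemma bernstein_algebra:
  fixes e g w :: "'a::real_inner" and v \<eta> \<tau> \<eta>' s b \<beta> c m M F n SV Ve SF Fe Vt Ft :: real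
  assumes s: "s > 0" "v\<^sup>2 \<le> s" and v: "v > 0" and \<beta>: "\<beta> = b * v\<^sup>2 / s" "\<beta> > -1" "m \<le> 1 + \<beta>"
    and m: "m > 0" and e: "norm e = 1" and g: "g \<bullet> g \<le> 1" and n: "n \<ge> 0"
    and \<eta>: "0 < \<eta>" "\<eta> \<le> 1" "\<eta>' \<le> 1" and \<tau>: "0 \<le> \<tau>" "\<tau> \<le> 1/2" and F: "\<bar>F\<bar> \<le> M"
    and c: "c * m = 2 * (4 + n + 8 * \<bar>b\<bar>)"
    and grad: "\<eta> *\<^sub>R (v *\<^sub>R g + \<eta> *\<^sub>R w) + (c * F) *\<^sub>R e = 0"
    and time: "0 \<le> \<eta> * \<eta>' * v\<^sup>2 + \<eta>\<^sup>2 * v * Vt + c * F * Ft"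
    and space: "(v\<^sup>2 * (g \<bullet> g) - 2 * \<tau> * \<eta> * v\<^sup>2 * n + 4 * \<eta> * v * (g \<bullet> w) + \<eta>\<^sup>2 * (w \<bullet> w)
        + \<eta>\<^sup>2 * v * SV + c * v\<^sup>2 + c * F * SF)
      + \<beta> * (v\<^sup>2 * (g \<bullet> e)\<^sup>2 - 2 * \<tau> * \<eta> * v\<^sup>2 + 4 * \<eta> * v * (g \<bullet> e) * (w \<bullet> e) + \<eta>\<^sup>2 * (w \<bullet> e)\<^sup>2
        + \<eta>\<^sup>2 * v * Ve + c * v\<^sup>2 + c * F * Fe) \<le> 0"
    and Vt: "Vt = SV + \<beta> * Ve + 2 * b * v / s * (w \<bullet> w) - 2 * b * v ^ 3 / s\<^sup>2 * (w \<bullet> e)\<^sup>2"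
    and Ft: "Ft = SF + \<beta> * Fe"
  shows "\<eta>\<^sup>2 * v\<^sup>2 \<le> 8 * \<bar>b\<bar> * c * M\<^sup>2 / m"
proof -
  \<comment> \<open>From here on \<open>s\<close> enters only through \<open>k\<close>, of which
    only 0 \<le> k \<le> 1 is used; this is what keeps the bound uniform in \<epsilon>.\<close>
  define k where "k = v\<^sup>2 / s"
  have k: "0 \<le> k" "k \<le> 1" and \<beta>k: "\<beta> = b * k"
    using s \<beta>(1) by (auto simp: k_def)
  have b\<beta>: "\<bar>\<beta>\<bar> \<le> \<bar>b\<bar>"
    using k by (simp add: \<beta>k abs_mult mult_left_le)
  have c0: "c > 0"
    using c m n by (smt (verit) zero_less_mult_pos2)
  have we: "(w \<bullet> e)\<^sup>2 \<le> w \<bullet> w"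
    using Cauchy_Schwarz_ineq[of w e] e by (simp add: norm_eq_1)

  define R where "R = 2 * b * k * (w \<bullet> w - k * (w \<bullet> e)\<^sup>2)"
  have "v * (2 * b * v / s * (w \<bullet> w) - 2 * b * v ^ 3 / s\<^sup>2 * (w \<bullet> e)\<^sup>2) = R"
    unfolding R_def k_def using s by (simp add: field_simps power2_eq_square power3_eq_cube)
  then have vVt: "v * Vt = v * SV + \<beta> * v * Ve + R"
    by (simp add: Vt algebra_simps)
  have "0 \<le> w \<bullet> w - k * (w \<bullet> e)\<^sup>2"
    using mult_mono[OF k(2) we] by simp
  moreover have "w \<bullet> w - k * (w \<bullet> e)\<^sup>2 \<le> w \<bullet> w"
    using k by simp
  ultimately have "b * (k * (w \<bullet> w - k * (w \<bullet> e)\<^sup>2)) \<le> \<bar>b\<bar> * (1 * (w \<bullet> w))"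
    using k by (intro mult_mono) auto
  then have "2 * \<eta>\<^sup>2 * (b * (k * (w \<bullet> w - k * (w \<bullet> e)\<^sup>2))) \<le> 2 * \<eta>\<^sup>2 * (\<bar>b\<bar> * (1 * (w \<bullet> w)))"
    by (intro mult_left_mono) auto
  then have R: "\<eta>\<^sup>2 * R \<le> 2 * \<bar>b\<bar> * (\<eta>\<^sup>2 * (w \<bullet> w))"
    by (simp only: R_def mult_1_left mult_ac)

  \<comment> \<open>Dividing the first order condition by \<eta> expresses \<eta> w through
    \<open>g\<close> and \<open>e\<close>, so that \<eta>^2 |w|^2 is bounded by v^2 and c^2 M^2 /
    \<eta>^2, with no second derivatives of u left.\<close>
  have "\<eta> *\<^sub>R (\<eta> *\<^sub>R w + (v *\<^sub>R g + (c * F / \<eta>) *\<^sub>R e)) =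
      \<eta> *\<^sub>R (v *\<^sub>R g + \<eta> *\<^sub>R w) + (\<eta> * (c * F / \<eta>)) *\<^sub>R e"
    by (simp add: scaleR_add_right)
  also have "\<dots> = 0"
    using grad \<eta>(1) by simp
  finally have \<eta>w: "\<eta> *\<^sub>R w = - (v *\<^sub>R g + (c * F / \<eta>) *\<^sub>R e)"
    unfolding eq_neg_iff_add_eq_0 using \<eta>(1) by simp
  let ?N = "(c * M / \<eta>)\<^sup>2"
  have "(norm (\<eta> *\<^sub>R w))\<^sup>2 \<le> (v * norm g + c * M / \<eta>)\<^sup>2"
  proof (rule power_mono)
    have "norm (\<eta> *\<^sub>R w) \<le> norm (v *\<^sub>R g) + norm ((c * F / \<eta>) *\<^sub>R e)"
      unfolding \<eta>w norm_minus_cancel by (rule norm_triangle_ineq)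
    also have "\<dots> \<le> v * norm g + c * M / \<eta>"
      using v e \<eta>(1) c0 F by (simp add: abs_mult divide_right_mono)
    finally show "norm (\<eta> *\<^sub>R w) \<le> v * norm g + c * M / \<eta>" .
  qed simp
  also have "\<dots> \<le> 2 * (v * norm g)\<^sup>2 + 2 * ?N"
    using sum_squares_bound[of "v * norm g" "c * M / \<eta>"] by (simp add: power2_sum)
  also have "(v * norm g)\<^sup>2 \<le> v\<^sup>2 * 1"
    using g by (simp add: power_mult_distrib power2_norm_eq_inner mult_left_le)
  finally have \<eta>w2: "\<eta>\<^sup>2 * (w \<bullet> w) \<le> 2 * v\<^sup>2 + 2 * ?N"
    by (simp add: power2_norm_eq_inner power_mult_distrib)

  \<comment> \<open>The mixed term \<open>a(\<nabla>\<eta>, \<nabla>v)\<close> is absorbed by \<open>\<eta>\<^sup>2 a(\<nabla>v, \<nabla>v)\<close>.\<close>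
  have "0 \<le> (2 *\<^sub>R v *\<^sub>R g + \<eta> *\<^sub>R w) \<bullet> (2 *\<^sub>R v *\<^sub>R g + \<eta> *\<^sub>R w) + \<beta> * ((2 *\<^sub>R v *\<^sub>R g + \<eta> *\<^sub>R w) \<bullet> e)\<^sup>2"
    using rank_one_form_bounds[OF e \<beta>(2)] by blast
  also have "\<dots> = 4 * v\<^sup>2 * (g \<bullet> g + \<beta> * (g \<bullet> e)\<^sup>2)
      + (4 * \<eta> * v * (g \<bullet> w) + 4 * \<beta> * \<eta> * v * (g \<bullet> e) * (w \<bullet> e))
      + \<eta>\<^sup>2 * (w \<bullet> w + \<beta> * (w \<bullet> e)\<^sup>2)"
    by (simp add: inner_add_left inner_add_right inner_commute[of w g] power2_eq_square algebra_simps)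
  finally have square: "0 \<le> \<dots>" .
  have "g \<bullet> g + \<beta> * (g \<bullet> e)\<^sup>2 \<le> (1 + \<bar>\<beta>\<bar>) * (g \<bullet> g)"
    using rank_one_form_bounds[OF e \<beta>(2)] by blast
  also have "\<dots> \<le> (1 + \<bar>b\<bar>) * 1"
    using b\<beta> g by (intro mult_mono) auto
  finally have G: "v\<^sup>2 * (g \<bullet> g + \<beta> * (g \<bullet> e)\<^sup>2) \<le> v\<^sup>2 * (1 + \<bar>b\<bar>)"
    by (intro mult_left_mono) auto

  have "\<tau> * \<eta> * (n + \<beta>) \<le> 1/2 * 1 * (n + \<bar>b\<bar>)"
  proof (cases "n + \<beta> \<ge> 0")
    case True
    then show ?thesis
      using \<eta> \<tau> b\<beta> n by (intro mult_mono) auto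
  next
    case False
    then have "\<tau> * \<eta> * (n + \<beta>) \<le> 0"
      using \<eta> \<tau> by (intro mult_nonneg_nonpos) auto
    then show ?thesis
      using n by simp
  qed
  then have T: "2 * (\<tau> * \<eta> * (n + \<beta>)) * v\<^sup>2 \<le> (n + \<bar>b\<bar>) * v\<^sup>2"
    by (intro mult_right_mono) auto
  have "\<eta> * \<eta>' \<le> 1"
    using mult_mono[of \<eta> 1 \<eta>' 1] \<eta> by (cases "\<eta>' \<ge> 0") (auto simp: mult_pos_neg order.trans[OF mult_nonneg_nonpos])
  then have E: "\<eta> * \<eta>' * v\<^sup>2 \<le> 1 * v\<^sup>2"
    by (intro mult_right_mono) auto

  have "c * m * v\<^sup>2 \<le> c * (1 + \<beta>) * v\<^sup>2"
    using \<beta>(3) c0 by (intro mult_right_mono mult_left_mono) auto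
  \<comment> \<open>Subtracting the spatial from the temporal condition cancels \<open>SV\<close>,
    \<open>Ve\<close>, \<open>SF\<close> and \<open>Fe\<close>, since \<open>Vt\<close> and
    \<open>Ft\<close> contain them in the same combination.\<close>
  also have "\<dots> \<le> \<eta> * \<eta>' * v\<^sup>2 + \<eta>\<^sup>2 * R - v\<^sup>2 * (g \<bullet> g + \<beta> * (g \<bullet> e)\<^sup>2)
      + 2 * (\<tau> * \<eta> * (n + \<beta>)) * v\<^sup>2
      - (4 * \<eta> * v * (g \<bullet> w) + 4 * \<beta> * \<eta> * v * (g \<bullet> e) * (w \<bullet> e)) - \<eta>\<^sup>2 * (w \<bullet> w + \<beta> * (w \<bullet> e)\<^sup>2)"
  proof -
    have "0 \<le> \<eta> * \<eta>' * v\<^sup>2 + \<eta>\<^sup>2 * (v * SV + \<beta> * v * Ve + R) + c * F * (SF + \<beta> * Fe)"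
      using time by (simp add: vVt Ft mult.assoc)
    with space show ?thesis
      by (simp add: algebra_simps)
  qed
  \<comment> \<open>By \<open>square\<close>, the mixed term and the form in \<open>w\<close>, both
    with their minus signs, contribute at most 4 v^2 a(g,g), where a(g,g) is the form in
    \<open>G\<close>; the term - v^2 a(g,g) reduces the factor to 3.\<close>
  also have "\<dots> \<le> v\<^sup>2 + 2 * \<bar>b\<bar> * (2 * v\<^sup>2 + 2 * ?N) + 3 * (v\<^sup>2 * (1 + \<bar>b\<bar>)) + (n + \<bar>b\<bar>) * v\<^sup>2"
  proof -
    have "2 * \<bar>b\<bar> * (\<eta>\<^sup>2 * (w \<bullet> w)) \<le> 2 * \<bar>b\<bar> * (2 * v\<^sup>2 + 2 * ?N)"
      using \<eta>w2 by (intro mult_left_mono) auto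
    with R E T G square show ?thesis
      by linarith
  qed
  \<comment> \<open>The coefficients of v^2 are 1 + 4 |b| + 3 (1 + |b|) + n + |b| = 4 + n + 8 |b|.
    The constant \<open>c\<close> is chosen to make this half of c m, so half of the left-hand side
    survives.\<close>
  also have "\<dots> = c * m / 2 * v\<^sup>2 + 4 * \<bar>b\<bar> * ?N"
    by (simp add: c algebra_simps)
  finally have "c * m * v\<^sup>2 \<le> c * m / 2 * v\<^sup>2 + 4 * \<bar>b\<bar> * ?N" .
  moreover have "4 * \<bar>b\<bar> * ?N = c * (4 * \<bar>b\<bar> * c * M\<^sup>2 / \<eta>\<^sup>2)"
    by (simp add: power_mult_distrib power_divide power2_eq_square)
  moreover have "c * m * v\<^sup>2 - c * m / 2 * v\<^sup>2 = c * (m / 2 * v\<^sup>2)"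
    by (simp add: field_simps)
  ultimately have "c * (m / 2 * v\<^sup>2) \<le> c * (4 * \<bar>b\<bar> * c * M\<^sup>2 / \<eta>\<^sup>2)"
    by linarith
  then have "m / 2 * v\<^sup>2 \<le> 4 * \<bar>b\<bar> * c * M\<^sup>2 / \<eta>\<^sup>2"
    using c0 by (rule mult_left_le_imp_le)
  then show ?thesis
    using m \<eta>(1) by (simp add: field_simps)
qed

section \<open>First and second order conditions for \<eta>^2 v^2 + c u^2 along lines\<close>

lemma weighted_square_max_1d:
  fixes A A' B B' \<eta> \<eta>' :: "real \<Rightarrow> real"
  assumes d: "d > 0"
    and D: "\<And>h. \<bar>h\<bar> < d \<Longrightarrow> (A has_real_derivative A' h) (at h)"
      "\<And>h. \<bar>h\<bar> < d \<Longrightarrow> (B has_real_derivative B' h) (at h)"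
      "\<And>h. \<bar>h\<bar> < d \<Longrightarrow> (\<eta> has_real_derivative \<eta>' h) (at h)"
    and D': "(A' has_real_derivative A'') (at 0)" "(B' has_real_derivative B'') (at 0)"
      "(\<eta>' has_real_derivative \<eta>'') (at 0)"
    and max: "\<And>h. \<bar>h\<bar> < d \<Longrightarrow> (\<eta> h * B h)\<^sup>2 + c * (A h)\<^sup>2 \<le> (\<eta> 0 * B 0)\<^sup>2 + c * (A 0)\<^sup>2"
  shows "\<eta> 0 * B 0 * (\<eta>' 0 * B 0 + \<eta> 0 * B' 0) + c * A 0 * A' 0 = 0"
    and "(\<eta>' 0 * B 0 + \<eta> 0 * B' 0)\<^sup>2 + \<eta> 0 * B 0 * (\<eta>'' * B 0 + 2 * \<eta>' 0 * B' 0 + \<eta> 0 * B'')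
      + c * ((A' 0)\<^sup>2 + A 0 * A'') \<le> 0"
proof -
  let ?f = "\<lambda>h. (\<eta> h * B h)\<^sup>2 + c * (A h)\<^sup>2"
  let ?f' = "\<lambda>h. 2 * (\<eta> h * B h * (\<eta>' h * B h + \<eta> h * B' h) + c * A h * A' h)"
  let ?l = "2 * ((\<eta>' 0 * B 0 + \<eta> 0 * B' 0)\<^sup>2
      + \<eta> 0 * B 0 * (\<eta>'' * B 0 + 2 * \<eta>' 0 * B' 0 + \<eta> 0 * B'') + c * ((A' 0)\<^sup>2 + A 0 * A''))"
  have 1: "(?f has_real_derivative ?f' h) (at h)" if "\<bar>h\<bar> < d" for h
    by (rule derivative_eq_intros D that refl)+ (simp add: algebra_simps)
  have 2: "(?f' has_real_derivative ?l) (at 0)"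
    using d by (auto intro!: derivative_eq_intros D D' simp: algebra_simps power2_eq_square)
  show "\<eta> 0 * B 0 * (\<eta>' 0 * B 0 + \<eta> 0 * B' 0) + c * A 0 * A' 0 = 0"
    using second_derivative_le_0_at_local_max(1)[of d ?f ?f', OF d max 1 2] by simp
  show "(\<eta>' 0 * B 0 + \<eta> 0 * B' 0)\<^sup>2 + \<eta> 0 * B 0 * (\<eta>'' * B 0 + 2 * \<eta>' 0 * B' 0 + \<eta> 0 * B'')
      + c * ((A' 0)\<^sup>2 + A 0 * A'') \<le> 0"
    using second_derivative_le_0_at_local_max(2)[of d ?f ?f', OF d max 1 2] by simp
qed

text \<open>Only earlier times are compared, because the maximum may lie on the top face of the
  cylinder.\<close>

lemma one_sided_max_derivative:
  fixes f :: "real \<Rightarrow> real"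
  assumes "(f has_real_derivative l) (at 0)" "d > 0" "\<And>h. 0 < h \<Longrightarrow> h < d \<Longrightarrow> f (- h) \<le> f 0"
  shows "0 \<le> l"
proof (rule ccontr)
  assume "\<not> 0 \<le> l"
  then obtain k where k: "k > 0" "\<And>h. 0 < h \<Longrightarrow> h < k \<Longrightarrow> f 0 < f (- h)"
    using DERIV_neg_dec_left[OF assms(1)] by auto
  have "0 < min d k / 2" "min d k / 2 < d" "min d k / 2 < k"
    using assms(2) k(1) by auto
  then show False
    using k(2) assms(3) by (meson not_le)
qed

lemma open_contains_segment:
  fixes z v :: "'a::real_normed_vector"
  assumes "open S" "z \<in> S"
  shows "\<exists>d>0. \<forall>h. \<bar>h\<bar> < d \<longrightarrow> z + h *\<^sub>R v \<in> S"
proof -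
  have "open ((\<lambda>h. z + h *\<^sub>R v) -` S)"
    by (intro open_vimage assms continuous_intros)
  moreover have "0 \<in> (\<lambda>h. z + h *\<^sub>R v) -` S"
    using assms(2) by simp
  ultimately obtain d where "d > 0" "ball 0 d \<subseteq> (\<lambda>h. z + h *\<^sub>R v) -` S"
    unfolding open_contains_ball by blast
  then show ?thesis
    by (intro exI[of _ d]) (auto simp: subset_iff dist_real_def)
qed

definition cutoff :: "'a::euclidean_space \<times> real \<Rightarrow> real" where
  "cutoff z = (1/2 - (norm (fst z))\<^sup>2) * (snd z + 1/2)"

text \<open>Along a spatial line the cutoff is a quadratic polynomial in \<open>h\<close>, with
  first derivative \<open>a\<close> at 0 and second derivative -2 \<tau> |\<xi>|^2, which reduces
  the claim to one dimension.\<close>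

lemma weighted_square_spatial_max:
  fixes F V :: "'a::euclidean_space \<times> real \<Rightarrow> real"
  assumes F: "smooth_on S F" and V: "smooth_on S V" and S: "open S" "z \<in> S" and d: "d > 0"
    and max: "\<And>h. \<bar>h\<bar> < d \<Longrightarrow>
      (cutoff (z + h *\<^sub>R (\<xi>, 0)) * V (z + h *\<^sub>R (\<xi>, 0)))\<^sup>2 + c * (F (z + h *\<^sub>R (\<xi>, 0)))\<^sup>2
      \<le> (cutoff z * V z)\<^sup>2 + c * (F z)\<^sup>2"
    and \<tau>: "\<tau> = snd z + 1/2" and a: "a = - 2 * \<tau> * (fst z \<bullet> \<xi>)"
  shows "cutoff z * V z * (a * V z + cutoff z * sdir \<xi> V z) + c * F z * sdir \<xi> F z = 0"
    and "(a * V z + cutoff z * sdir \<xi> V z)\<^sup>2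
      + cutoff z * V z * (- 2 * \<tau> * (\<xi> \<bullet> \<xi>) * V z + 2 * a * sdir \<xi> V z + cutoff z * sdir \<xi> (sdir \<xi> V) z)
      + c * ((sdir \<xi> F z)\<^sup>2 + F z * sdir \<xi> (sdir \<xi> F) z) \<le> 0"
proof -
  obtain d' where d': "d' > 0" "\<And>h. \<bar>h\<bar> < d' \<Longrightarrow> z + h *\<^sub>R (\<xi>, 0) \<in> S"
    using open_contains_segment[OF S, of "(\<xi>, 0)"] by blast
  let ?l = "\<lambda>h::real. z + h *\<^sub>R (\<xi>, 0)"
  let ?e = "\<lambda>h. (1/2 - (fst z \<bullet> fst z + 2 * h * (fst z \<bullet> \<xi>) + h\<^sup>2 * (\<xi> \<bullet> \<xi>))) * \<tau>"
  let ?e' = "\<lambda>h. - (2 * (fst z \<bullet> \<xi>) + 2 * h * (\<xi> \<bullet> \<xi>)) * \<tau>"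
  have e: "cutoff (?l h) = ?e h" for h
    unfolding power2_norm_eq_inner cutoff_def \<tau>
    by (simp add: inner_add_left inner_add_right inner_commute[of \<xi> "fst z"] power2_eq_square algebra_simps)
  have e0: "cutoff z = ?e 0"
    using e[of 0] by (simp flip: zero_prod_def)
  have D: "((\<lambda>h. f (?l h)) has_real_derivative sdir \<xi> f (?l h)) (at h)"
    if "smooth_on S f" "\<bar>h\<bar> < min d d'" for f h
    using that d'(2) by (intro DERIV_along_line smooth_on_differentiable[OF _ S(1)]) auto
  have D': "((\<lambda>h. sdir \<xi> f (?l h)) has_real_derivative sdir \<xi> (sdir \<xi> f) z) (at 0)"
    if "smooth_on S f" for f
    using that S by (intro DERIV_along_line_0 smooth_on_differentiable[OF smooth_on_ddir])
  have De: "(?e has_real_derivative ?e' h) (at h)" for h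
    by (auto intro!: derivative_eq_intros simp: algebra_simps)
  have De': "(?e' has_real_derivative - 2 * \<tau> * (\<xi> \<bullet> \<xi>)) (at 0)"
    by (auto intro!: derivative_eq_intros simp: algebra_simps)
  have m: "min d d' > 0"
    using d d' by simp
  have max': "(?e h * V (?l h))\<^sup>2 + c * (F (?l h))\<^sup>2 \<le> (?e 0 * V (?l 0))\<^sup>2 + c * (F (?l 0))\<^sup>2"
    if "\<bar>h\<bar> < min d d'" for h
    using max[of h] that unfolding e e0 by (simp flip: zero_prod_def)
  have a: "a = ?e' 0"
    by (simp add: a)
  note * = weighted_square_max_1d[OF m D[OF F] D[OF V] De D'[OF F] D'[OF V] De' max', simplified]
  show "cutoff z * V z * (a * V z + cutoff z * sdir \<xi> V z) + c * F z * sdir \<xi> F z = 0"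
    using *(1) unfolding a e0 by (simp flip: zero_prod_def)
  show "(a * V z + cutoff z * sdir \<xi> V z)\<^sup>2
      + cutoff z * V z * (- 2 * \<tau> * (\<xi> \<bullet> \<xi>) * V z + 2 * a * sdir \<xi> V z + cutoff z * sdir \<xi> (sdir \<xi> V) z)
      + c * ((sdir \<xi> F z)\<^sup>2 + F z * sdir \<xi> (sdir \<xi> F) z) \<le> 0"
    using *(2) unfolding a e0 by (simp flip: zero_prod_def)
qed

text \<open>The factor 1/2 - |x|^2 is the time derivative of the cutoff; the one-sided condition is
  divided by 2.\<close>

lemma weighted_square_temporal_max:
  fixes F V :: "'a::euclidean_space \<times> real \<Rightarrow> real"
  assumes F: "smooth_on S F" and V: "smooth_on S V" and S: "open S" "z \<in> S" and d: "d > 0"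
    and max: "\<And>h. 0 < h \<Longrightarrow> h < d \<Longrightarrow>
      (cutoff (z + (- h) *\<^sub>R (0, 1)) * V (z + (- h) *\<^sub>R (0, 1)))\<^sup>2 + c * (F (z + (- h) *\<^sub>R (0, 1)))\<^sup>2
      \<le> (cutoff z * V z)\<^sup>2 + c * (F z)\<^sup>2"
  shows "0 \<le> cutoff z * (1/2 - (norm (fst z))\<^sup>2) * (V z)\<^sup>2 + (cutoff z)\<^sup>2 * V z * tdir V z
    + c * F z * tdir F z"
proof -
  let ?l = "\<lambda>h::real. z + h *\<^sub>R (0, 1)"
  let ?e = "\<lambda>h. (1/2 - (norm (fst z))\<^sup>2) * (snd z + h + 1/2)"
  define A where "A h = F (?l h)" for h
  define B where "B h = V (?l h)" for h
  have e: "cutoff (?l h) = ?e h" for h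
    by (simp add: cutoff_def)
  have z0: "cutoff z = ?e 0" "A 0 = F z" "B 0 = V z"
    by (simp_all add: cutoff_def A_def B_def flip: zero_prod_def)
  have DA: "(A has_real_derivative tdir F z) (at 0)" and DB: "(B has_real_derivative tdir V z) (at 0)"
    unfolding A_def B_def
    by (intro DERIV_along_line_0 smooth_on_differentiable[OF F S] smooth_on_differentiable[OF V S])+
  have "((\<lambda>h. (?e h * B h)\<^sup>2 + c * (A h)\<^sup>2) has_real_derivative
      2 * (?e 0 * (1/2 - (norm (fst z))\<^sup>2) * (B 0)\<^sup>2 + (?e 0)\<^sup>2 * B 0 * tdir V z + c * A 0 * tdir F z)) (at 0)"
    by (auto intro!: derivative_eq_intros DA DB simp: algebra_simps power2_eq_square)
  from one_sided_max_derivative[OF this d] show ?thesis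
    using max unfolding z0 e A_def[symmetric] B_def[symmetric] by simp
qed

subsection \<open>The gradient estimate\<close>

text \<open>The direction \<open>e\<close> is constant, so \<open>sdir e F\<close> is smooth and its
  maximum conditions are available in every direction. They are collected in a bilinear form, traced
  against the coefficient matrix, and passed to \<open>bernstein_algebra\<close>.\<close>

lemma bernstein_at_max:
  fixes F :: "'a::euclidean_space \<times> real \<Rightarrow> real"
  assumes F: "smooth_on S F" "open S" "z \<in> S" and eq: "p_heat_on p \<epsilon> S F"
    and p: "p > 1" and \<epsilon>: "\<epsilon> > 0"
    and e: "norm e = 1" and v: "v > 0" and grad: "\<And>i. i \<in> Basis \<Longrightarrow> sdir i F z = v * (e \<bullet> i)"
    and z: "(norm (fst z))\<^sup>2 < 1/2" "-1/2 < snd z" "snd z \<le> 0"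
    and c: "c * min 1 (p - 1) = 2 * (4 + real DIM('a) + 8 * \<bar>p - 2\<bar>)"
    and d: "d > 0"
    and space_max: "\<And>h \<xi>. \<bar>h\<bar> * norm \<xi> < d \<Longrightarrow>
      (cutoff (z + h *\<^sub>R (\<xi>, 0)) * sdir e F (z + h *\<^sub>R (\<xi>, 0)))\<^sup>2 + c * (F (z + h *\<^sub>R (\<xi>, 0)))\<^sup>2
      \<le> (cutoff z * sdir e F z)\<^sup>2 + c * (F z)\<^sup>2"
    and time_max: "\<And>h. 0 < h \<Longrightarrow> h < d \<Longrightarrow>
      (cutoff (z + (- h) *\<^sub>R (0, 1)) * sdir e F (z + (- h) *\<^sub>R (0, 1)))\<^sup>2
        + c * (F (z + (- h) *\<^sub>R (0, 1)))\<^sup>2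
      \<le> (cutoff z * sdir e F z)\<^sup>2 + c * (F z)\<^sup>2"
    and M: "\<bar>F z\<bar> \<le> M"
  shows "(cutoff z)\<^sup>2 * v\<^sup>2 \<le> 8 * \<bar>p - 2\<bar> * c * M\<^sup>2 / min 1 (p - 1)"
proof -
  define V where "V = sdir e F"
  define \<tau> where "\<tau> = snd z + 1/2"
  define g where "g = (- 2 * \<tau>) *\<^sub>R fst z"
  define w where "w = (\<Sum>i\<in>Basis. sdir i V z *\<^sub>R i)"
  define s where "s = v\<^sup>2 + \<epsilon>\<^sup>2"
  define \<beta> where "\<beta> = (p - 2) * v\<^sup>2 / s"
  let ?\<eta> = "cutoff z"
  have V: "smooth_on S V"
    unfolding V_def using F(1) by (rule smooth_on_ddir)
  note dF = smooth_on_differentiable[OF F] and dV = smooth_on_differentiable[OF V F(2,3)]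
  have F\<xi>: "sdir \<xi> F z = v * (e \<bullet> \<xi>)" for \<xi>
  proof -
    have "sdir \<xi> F z = v * (\<Sum>i\<in>Basis. (\<xi> \<bullet> i) * (e \<bullet> i))"
      using sdir_expansion[OF dF, of \<xi>] by (simp add: grad sum_distrib_left mult_ac)
    then show ?thesis
      by (simp add: euclidean_inner[of e \<xi>] mult.commute)
  qed
  have Vz: "V z = v"
    using e by (simp add: V_def F\<xi> norm_eq_1)
  have V\<xi>: "sdir \<xi> V z = w \<bullet> \<xi>" for \<xi>
    unfolding w_def by (rule sdir_eq_inner[OF dV])
  have \<tau>: "0 \<le> \<tau>" "\<tau> \<le> 1/2"
    using z by (auto simp: \<tau>_def)
  have \<eta>: "0 < ?\<eta>" "?\<eta> \<le> 1"
  proof -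
    show "0 < ?\<eta>"
      using z unfolding cutoff_def by (intro mult_pos_pos) auto
    have "1/2 - (norm (fst z))\<^sup>2 \<le> 1"
      using zero_le_power2[of "norm (fst z)"] by linarith
    then have "?\<eta> \<le> 1 * 1"
      using z unfolding cutoff_def by (intro mult_mono) auto
    then show "?\<eta> \<le> 1"
      by simp
  qed

  have ls: "\<exists>d'>0. \<forall>h. \<bar>h\<bar> < d' \<longrightarrow> \<bar>h\<bar> * norm \<xi> < d" for \<xi> :: 'a
  proof (intro exI conjI allI impI)
    have pos: "norm \<xi> + 1 > 0"
      using norm_ge_zero[of \<xi>] by linarith
    then show "d / (norm \<xi> + 1) > 0"
      using d by simp
    fix h assume "\<bar>h\<bar> < d / (norm \<xi> + 1)"
    then have "\<bar>h\<bar> * (norm \<xi> + 1) < d"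
      using pos by (simp add: pos_less_divide_eq)
    then show "\<bar>h\<bar> * norm \<xi> < d"
      by (simp add: distrib_left)
  qed
  have var: "?\<eta> * v * ((g \<bullet> \<xi>) * v + ?\<eta> * (w \<bullet> \<xi>)) + c * F z * (v * (e \<bullet> \<xi>)) = 0"
    "((g \<bullet> \<xi>) * v + ?\<eta> * (w \<bullet> \<xi>))\<^sup>2
      + ?\<eta> * v * (- 2 * \<tau> * (\<xi> \<bullet> \<xi>) * v + 2 * (g \<bullet> \<xi>) * (w \<bullet> \<xi>) + ?\<eta> * sdir \<xi> (sdir \<xi> V) z)
      + c * ((v * (e \<bullet> \<xi>))\<^sup>2 + F z * sdir \<xi> (sdir \<xi> F) z) \<le> 0" for \<xi>
  proof -
    obtain d' where d': "d' > 0" "\<And>h. \<bar>h\<bar> < d' \<Longrightarrow> \<bar>h\<bar> * norm \<xi> < d"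
      using ls[of \<xi>] by blast
    have a: "g \<bullet> \<xi> = - 2 * \<tau> * (fst z \<bullet> \<xi>)"
      by (simp add: g_def)
    note * = weighted_square_spatial_max[OF F(1) V F(2,3) d'(1) space_max[OF d'(2), folded V_def] \<tau>_def a]
    show "?\<eta> * v * ((g \<bullet> \<xi>) * v + ?\<eta> * (w \<bullet> \<xi>)) + c * F z * (v * (e \<bullet> \<xi>)) = 0"
      using *(1) unfolding Vz V\<xi> F\<xi> .
    show "((g \<bullet> \<xi>) * v + ?\<eta> * (w \<bullet> \<xi>))\<^sup>2
      + ?\<eta> * v * (- 2 * \<tau> * (\<xi> \<bullet> \<xi>) * v + 2 * (g \<bullet> \<xi>) * (w \<bullet> \<xi>) + ?\<eta> * sdir \<xi> (sdir \<xi> V) z)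
      + c * ((v * (e \<bullet> \<xi>))\<^sup>2 + F z * sdir \<xi> (sdir \<xi> F) z) \<le> 0"
      using *(2) unfolding Vz V\<xi> F\<xi> .
  qed

  have grad0: "?\<eta> *\<^sub>R (v *\<^sub>R g + ?\<eta> *\<^sub>R w) + (c * F z) *\<^sub>R e = 0" (is "?X = 0")
  proof -
    \<comment> \<open>The first order condition is tested in the direction of the vector that is to
      vanish.\<close>
    have "v * (?X \<bullet> ?X) = 0"
      using var(1)[of ?X] by (simp add: inner_add_left algebra_simps)
    then show ?thesis
      using v by simp
  qed

  have time: "0 \<le> ?\<eta> * (1/2 - (norm (fst z))\<^sup>2) * v\<^sup>2 + ?\<eta>\<^sup>2 * v * tdir V z + c * F z * tdir F z"
    using weighted_square_temporal_max[OF F(1) V F(2,3) d time_max[folded V_def]] unfolding Vz .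

  have s: "s > 0" "v\<^sup>2 \<le> s"
    using \<epsilon> by (auto simp: s_def add_nonneg_pos)
  have k: "0 \<le> v\<^sup>2 / s" "v\<^sup>2 / s \<le> 1"
    using s by auto
  \<comment> \<open>1 + \<beta> lies between 1 and p - 1, since \<beta> is p - 2 times a number in
    [0,1].\<close>
  have \<beta>m: "min 1 (p - 1) \<le> 1 + \<beta>"
  proof (cases "p \<ge> 2")
    case True
    then show ?thesis
      using s by (simp add: \<beta>_def)
  next
    case False
    then have "(p - 2) * 1 \<le> (p - 2) * (v\<^sup>2 / s)"
      using k by (intro mult_left_mono_neg) auto
    then show ?thesis
      by (simp add: \<beta>_def)
  qed
  have m: "min 1 (p - 1) > 0"
    using p by simp
  then have \<beta>: "\<beta> > -1"
    using \<beta>m by linarith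

  have g1: "g \<bullet> g \<le> 1"
  proof -
    have "g \<bullet> g = 4 * \<tau>\<^sup>2 * (norm (fst z))\<^sup>2"
      by (simp add: g_def power2_norm_eq_inner power2_eq_square[of \<tau>])
    also have "\<dots> \<le> 4 * (1/2)\<^sup>2 * (1/2)"
      using z \<tau> by (intro mult_mono power_mono) auto
    also have "\<dots> \<le> 1"
      by (simp add: power2_eq_square)
    finally show ?thesis .
  qed

  \<comment> \<open>The polarization of \<open>var(2)\<close>: half the spatial Hessian at
    \<open>z\<close> of the function that is maximal there. The first order products are symmetrized
    by hand.\<close>
  define B where "B \<xi> \<zeta> = v\<^sup>2 * ((g \<bullet> \<xi>) * (g \<bullet> \<zeta>)) - 2 * \<tau> * ?\<eta> * v\<^sup>2 * (\<xi> \<bullet> \<zeta>)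
      + 2 * ?\<eta> * v * ((g \<bullet> \<xi>) * (w \<bullet> \<zeta>) + (g \<bullet> \<zeta>) * (w \<bullet> \<xi>)) + ?\<eta>\<^sup>2 * ((w \<bullet> \<xi>) * (w \<bullet> \<zeta>))
      + ?\<eta>\<^sup>2 * v * sdir \<xi> (sdir \<zeta> V) z + c * v\<^sup>2 * ((e \<bullet> \<xi>) * (e \<bullet> \<zeta>)) + c * F z * sdir \<xi> (sdir \<zeta> F) z"
    for \<xi> \<zeta>
  have Bsym: "B \<xi> \<zeta> = B \<zeta> \<xi>" for \<xi> \<zeta>
    using ddir_commute[OF F, of "(\<xi>, 0)" "(\<zeta>, 0)"] ddir_commute[OF V F(2,3), of "(\<xi>, 0)" "(\<zeta>, 0)"]
    by (simp add: B_def inner_commute mult_ac add_ac)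
  have Bl: "linear (\<lambda>\<xi>. B \<xi> \<zeta>)" for \<zeta>
  proof -
    note l = linear_sdir[OF smooth_on_differentiable[OF smooth_on_ddir[OF F(1)] F(2,3)], of "(\<zeta>, 0)"]
      linear_sdir[OF smooth_on_differentiable[OF smooth_on_ddir[OF V] F(2,3)], of "(\<zeta>, 0)"]
    show ?thesis
      unfolding B_def
      by (rule linearI)
        (simp_all add: linear_add[OF l(1)] linear_add[OF l(2)] linear_cmul[OF l(1)] linear_cmul[OF l(2)]
          inner_add_right inner_add_left algebra_simps)
  qed
  have Br: "linear (B \<xi>)" for \<xi>
  proof -
    have "B \<xi> = (\<lambda>\<zeta>. B \<zeta> \<xi>)"
      using Bsym by blast
    then show ?thesis
      using Bl[of \<xi>] by simp
  qed
  have "B \<xi> \<xi> \<le> 0" for \<xi>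
    using var(2)[of \<xi>] by (simp add: B_def algebra_simps power2_eq_square)
  from trace_rank_one_perturbation[OF Bl Br this e \<beta>]
  have tr: "(\<Sum>i\<in>Basis. B i i) + \<beta> * B e e \<le> 0" .
  have gw: "(\<Sum>i\<in>Basis. x \<bullet> i * (y \<bullet> i)) = x \<bullet> y" for x y :: 'a
    by (rule euclidean_inner[symmetric])
  have ee: "e \<bullet> e = 1"
    using e by (simp add: norm_eq_1)
  have "B i i = v\<^sup>2 * ((g \<bullet> i) * (g \<bullet> i)) - 2 * \<tau> * ?\<eta> * v\<^sup>2 * 1
      + 4 * ?\<eta> * v * ((g \<bullet> i) * (w \<bullet> i)) + ?\<eta>\<^sup>2 * ((w \<bullet> i) * (w \<bullet> i))
      + ?\<eta>\<^sup>2 * v * sdir i (sdir i V) z + c * v\<^sup>2 * ((e \<bullet> i) * (e \<bullet> i)) + c * F z * sdir i (sdir i F) z"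
    if "i \<in> Basis" for i
    using that by (simp add: B_def)
  then have Bii: "(\<Sum>i\<in>Basis. B i i) = v\<^sup>2 * (g \<bullet> g) - 2 * \<tau> * ?\<eta> * v\<^sup>2 * real DIM('a)
      + 4 * ?\<eta> * v * (g \<bullet> w) + ?\<eta>\<^sup>2 * (w \<bullet> w)
      + ?\<eta>\<^sup>2 * v * (\<Sum>i\<in>Basis. sdir i (sdir i V) z) + c * v\<^sup>2
      + c * F z * (\<Sum>i\<in>Basis. sdir i (sdir i F) z)"
    by (simp add: sum.distrib sum_subtractf gw ee flip: sum_distrib_left)
  have Bee: "B e e = v\<^sup>2 * (g \<bullet> e)\<^sup>2 - 2 * \<tau> * ?\<eta> * v\<^sup>2 + 4 * ?\<eta> * v * (g \<bullet> e) * (w \<bullet> e)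
      + ?\<eta>\<^sup>2 * (w \<bullet> e)\<^sup>2 + ?\<eta>\<^sup>2 * v * sdir e (sdir e V) z + c * v\<^sup>2 + c * F z * sdir e (sdir e F) z"
    by (simp add: B_def ee power2_eq_square)
  note pde = p_heat_at_radial_gradient[OF F eq \<epsilon> e grad, folded s_def V_def, folded \<beta>_def]
  have w2: "(\<Sum>i\<in>Basis. (sdir i V z)\<^sup>2) = w \<bullet> w"
    by (simp add: V\<xi> euclidean_inner[of w w] power2_eq_square)
  show ?thesis
  proof (rule bernstein_algebra[OF s v \<beta>_def \<beta> \<beta>m m e g1 _ \<eta> _ \<tau> M c grad0 time])
    show "(v\<^sup>2 * (g \<bullet> g) - 2 * \<tau> * ?\<eta> * v\<^sup>2 * real DIM('a) + 4 * ?\<eta> * v * (g \<bullet> w) + ?\<eta>\<^sup>2 * (w \<bullet> w)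
        + ?\<eta>\<^sup>2 * v * (\<Sum>i\<in>Basis. sdir i (sdir i V) z) + c * v\<^sup>2
        + c * F z * (\<Sum>i\<in>Basis. sdir i (sdir i F) z))
      + \<beta> * (v\<^sup>2 * (g \<bullet> e)\<^sup>2 - 2 * \<tau> * ?\<eta> * v\<^sup>2 + 4 * ?\<eta> * v * (g \<bullet> e) * (w \<bullet> e) + ?\<eta>\<^sup>2 * (w \<bullet> e)\<^sup>2
        + ?\<eta>\<^sup>2 * v * sdir e (sdir e V) z + c * v\<^sup>2 + c * F z * sdir e (sdir e F) z) \<le> 0"
      using tr unfolding Bii Bee .
    show "tdir V z = (\<Sum>i\<in>Basis. sdir i (sdir i V) z) + \<beta> * sdir e (sdir e V) z
        + 2 * (p - 2) * v / s * (w \<bullet> w) - 2 * (p - 2) * v ^ 3 / s\<^sup>2 * (w \<bullet> e)\<^sup>2"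
      using pde(2) unfolding w2 V\<xi>[of e] .
    show "tdir F z = (\<Sum>i\<in>Basis. sdir i (sdir i F) z) + \<beta> * sdir e (sdir e F) z"
      by (rule pde(1)[unfolded V_def])
    show "1/2 - (norm (fst z))\<^sup>2 \<le> 1"
      using zero_le_power2[of "norm (fst z)"] by linarith
  qed auto
qed

text \<open>The auxiliary function \<Phi> is maximized over a compact cylinder. Where the cutoff or
  the gradient vanishes at the maximum, the bound on its weighted gradient term is trivial;
  otherwise \<open>bernstein_at_max\<close> applies.\<close>

lemma p_heat_gradient_estimate:
  fixes F :: "'a::euclidean_space \<times> real \<Rightarrow> real"
  defines "S \<equiv> ball 0 1 \<times> {-1<..<0}"
  assumes F: "smooth_on S F" and eq: "p_heat_on p \<epsilon> S F" and p: "p > 1" and \<epsilon>: "\<epsilon> > 0"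
    and c: "c * min 1 (p - 1) = 2 * (4 + real DIM('a) + 8 * \<bar>p - 2\<bar>)"
    and M: "\<And>z. z \<in> S \<Longrightarrow> \<bar>F z\<bar> \<le> M"
    and x: "norm x < 1/2" and t: "-1/4 < t" "t < 0"
  shows "(\<Sum>i\<in>Basis. (sdir i F (x, t))\<^sup>2) \<le> 256 * ((8 * \<bar>p - 2\<bar> / min 1 (p - 1) + 1) * c) * M\<^sup>2"
proof -
  have S: "open S"
    by (simp add: S_def open_Times)
  define w where "w z = (\<Sum>i\<in>Basis. (sdir i F z)\<^sup>2)" for z
  define \<Phi> where "\<Phi> z = (cutoff z)\<^sup>2 * w z + c * (F z)\<^sup>2" for z
  \<comment> \<open>The cylinder ends at the time \<open>t\<close> of the given point:
    \<open>S\<close> is open and does not reach time 0. The radius and the initial time are the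
    zeros of the cutoff.\<close>
  define K :: "('a \<times> real) set" where "K = cball 0 (sqrt (1/2)) \<times> {-1/2..t}"
  have K: "z \<in> K \<longleftrightarrow> (norm (fst z))\<^sup>2 \<le> 1/2 \<and> -1/2 \<le> snd z \<and> snd z \<le> t" for z
  proof -
    have "norm (fst z) \<le> sqrt (1/2) \<longleftrightarrow> (norm (fst z))\<^sup>2 \<le> 1/2"
      using real_le_rsqrt[of "norm (fst z)" "1/2"] sqrt_ge_absD[of "norm (fst z)" "1/2"] by auto
    then show ?thesis
      by (cases z) (simp add: K_def)
  qed
  have m: "min 1 (p - 1) > 0"
    using p by simp
  have c0: "c > 0"
    using c m by (smt (verit) of_nat_0_le_iff zero_less_mult_pos2)
  have KS: "K \<subseteq> S"
  proof
    fix z assume z: "z \<in> K"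
    then have "(norm (fst z))\<^sup>2 < 1\<^sup>2"
      by (simp add: K)
    then have "norm (fst z) < 1"
      by (rule power_less_imp_less_base) simp
    then show "z \<in> S"
      using z t by (cases z) (auto simp: K S_def)
  qed
  have "compact K"
    unfolding K_def by (intro compact_Times compact_cball) auto
  moreover have xt: "(x, t) \<in> K"
  proof -
    have "(norm x)\<^sup>2 \<le> (1/2)\<^sup>2"
      using x by (intro power_mono) auto
    then show ?thesis
      using t by (simp add: K power2_eq_square)
  qed
  moreover have "continuous_on K \<Phi>"
    unfolding \<Phi>_def cutoff_def w_def
    by (intro continuous_intros continuous_on_subset[OF _ KS] smooth_on_continuous_on smooth_on_ddir F)
  ultimately obtain z where z: "z \<in> K" and max: "\<And>y. y \<in> K \<Longrightarrow> \<Phi> y \<le> \<Phi> z"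
    by (metis continuous_attains_sup empty_iff)
  have zS: "z \<in> S"
    using z KS by blast
  have Fz: "c * (F z)\<^sup>2 \<le> c * M\<^sup>2"
    using power_mono[OF M[OF zS], of 2] c0 by simp
  have "(cutoff z)\<^sup>2 * w z \<le> 8 * \<bar>p - 2\<bar> * c * M\<^sup>2 / min 1 (p - 1)"
  proof (cases "cutoff z = 0 \<or> w z = 0")
    case True
    moreover have "0 \<le> 8 * \<bar>p - 2\<bar> * c * M\<^sup>2 / min 1 (p - 1)"
      using m c0 by (intro divide_nonneg_pos mult_nonneg_nonneg) auto
    ultimately show ?thesis
      by auto
  next
    case False
    define q where "q y = (\<Sum>i\<in>Basis. sdir i F y *\<^sub>R i)" for y
    have q: "sdir i F y = q y \<bullet> i" if "i \<in> Basis" for i y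
      using that by (simp add: q_def)
    have wq: "w y = (norm (q y))\<^sup>2" for y
      by (simp add: w_def q sum_inner_Basis_squares)
    define e where "e = q z /\<^sub>R norm (q z)"
    have v: "norm (q z) > 0"
      using False by (simp add: wq)
    then have e: "norm e = 1"
      by (simp add: e_def)
    have q\<xi>: "sdir \<xi> F y = q y \<bullet> \<xi>" if "y \<in> S" for \<xi> y
      unfolding q_def by (rule sdir_eq_inner[OF smooth_on_differentiable[OF F S that]])
    have Vz: "sdir e F z = norm (q z)"
      using v by (simp add: q\<xi>[OF zS] e_def dot_square_norm power2_eq_square)
    have grad: "sdir i F z = norm (q z) * (e \<bullet> i)" if "i \<in> Basis" for i
      using v that by (simp add: q e_def)
    \<comment> \<open>By Cauchy-Schwarz the function with frozen \<open>e\<close> lies below \<Phi>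
      on \<open>K\<close>, with equality at \<open>z\<close>; hence it inherits the maximum.\<close>
    have le: "(cutoff y * sdir e F y)\<^sup>2 + c * (F y)\<^sup>2 \<le> (cutoff z * sdir e F z)\<^sup>2 + c * (F z)\<^sup>2"
      if "y \<in> K" for y
    proof -
      have "\<bar>sdir e F y\<bar> \<le> norm (q y)"
        using q\<xi>[of y e] that KS Cauchy_Schwarz_ineq2[of "q y" e] e by auto
      then have "(sdir e F y)\<^sup>2 \<le> w y"
        using power_mono[of "\<bar>sdir e F y\<bar>" "norm (q y)" 2] by (simp add: wq)
      then have "(cutoff y * sdir e F y)\<^sup>2 + c * (F y)\<^sup>2 \<le> \<Phi> y"
        by (simp add: \<Phi>_def power_mult_distrib mult_left_mono)
      also have "\<dots> \<le> \<Phi> z"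
        using max that by blast
      finally show ?thesis
        by (simp add: \<Phi>_def wq Vz power_mult_distrib)
    qed
    have z': "(norm (fst z))\<^sup>2 < 1/2" "-1/2 < snd z" "snd z \<le> 0"
      using z t False by (auto simp: K cutoff_def less_le)
    have "open {y::'a. (norm y)\<^sup>2 < 1/2}"
      by (intro open_Collect_less continuous_intros)
    then obtain d1 where d1: "d1 > 0" "\<And>y. dist y (fst z) < d1 \<Longrightarrow> (norm y)\<^sup>2 < 1/2"
      using z'(1) unfolding open_dist by blast
    \<comment> \<open>Spatial steps stay where |x|^2 < 1/2, and backward time steps stay above
      -1/2.\<close>
    define d where "d = min d1 (snd z + 1/2)"
    have d: "d > 0"
      using d1 z' by (simp add: d_def)
    have "(cutoff z)\<^sup>2 * (norm (q z))\<^sup>2 \<le> 8 * \<bar>p - 2\<bar> * c * M\<^sup>2 / min 1 (p - 1)"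
    proof (rule bernstein_at_max[OF F S zS eq p \<epsilon> e v grad z' c d])
      fix h and \<xi> :: 'a assume "\<bar>h\<bar> * norm \<xi> < d"
      then have "(norm (fst z + h *\<^sub>R \<xi>))\<^sup>2 < 1/2"
        by (intro d1(2)) (simp add: d_def dist_norm)
      then have "z + h *\<^sub>R (\<xi>, 0) \<in> K"
        using z by (simp add: K)
      then show "(cutoff (z + h *\<^sub>R (\<xi>, 0)) * sdir e F (z + h *\<^sub>R (\<xi>, 0)))\<^sup>2 + c * (F (z + h *\<^sub>R (\<xi>, 0)))\<^sup>2
        \<le> (cutoff z * sdir e F z)\<^sup>2 + c * (F z)\<^sup>2"
        by (rule le)
    next
      fix h assume "0 < h" "h < d"
      then have "z + (- h) *\<^sub>R (0, 1) \<in> K"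
        using z by (simp add: K d_def)
      then show "(cutoff (z + (- h) *\<^sub>R (0, 1)) * sdir e F (z + (- h) *\<^sub>R (0, 1)))\<^sup>2
          + c * (F (z + (- h) *\<^sub>R (0, 1)))\<^sup>2 \<le> (cutoff z * sdir e F z)\<^sup>2 + c * (F z)\<^sup>2"
        by (rule le)
    qed (use M zS in auto)
    then show ?thesis
      by (simp add: wq)
  qed
  then have bound: "\<Phi> z \<le> (8 * \<bar>p - 2\<bar> / min 1 (p - 1) + 1) * c * M\<^sup>2"
    using Fz by (simp add: \<Phi>_def distrib_right)
  \<comment> \<open>For |x| < 1/2 and t > -1/4 both factors of the cutoff are at least 1/4; this is
    the source of the factor 256 = 16^2.\<close>
  have "(1/16)\<^sup>2 * w (x, t) \<le> (cutoff (x, t))\<^sup>2 * w (x, t)"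
  proof (intro mult_right_mono power_mono)
    have "(norm x)\<^sup>2 \<le> (1/2)\<^sup>2"
      using x by (intro power_mono) auto
    then have "1/4 * (1/4) \<le> cutoff (x, t)"
      unfolding cutoff_def using t by (intro mult_mono) (auto simp: power2_eq_square)
    then show "1/16 \<le> cutoff (x, t)"
      by simp
  qed (auto simp: w_def sum_nonneg)
  also have "\<dots> \<le> \<Phi> (x, t)"
    using c0 by (simp add: \<Phi>_def)
  also have "\<dots> \<le> \<Phi> z"
    using max xt by blast
  finally show ?thesis
    using bound by (simp add: w_def power2_eq_square)
qed

section \<open>Return to \<open>pgrad\<close>, \<open>ptime\<close> and \<open>pd2\<close>\<close>

theorem theorem3p2:
  fixes p :: real
  assumes "1 < p"
  shows "\<exists>C>0. \<forall>(\<epsilon>::real) (u::'a::euclidean_space \<Rightarrow> real \<Rightarrow> real) (M::real).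
    \<epsilon> > 0 \<longrightarrow>
    smooth_on (ball 0 1 \<times> {-1<..<0}) (\<lambda>z. u (fst z) (snd z)) \<longrightarrow>
    (\<forall>x t. x \<in> ball 0 1 \<and> t \<in> {-1<..<0} \<longrightarrow>
       ptime u x t = (\<Sum>i\<in>Basis. \<Sum>j\<in>Basis. acoef p \<epsilon> (pgrad u x t) i j * pd2 u i j x t)) \<longrightarrow>
    (\<forall>x t. x \<in> ball 0 1 \<and> t \<in> {-1<..<0} \<longrightarrow> \<bar>u x t\<bar> \<le> M) \<longrightarrow>
    (\<forall>x t. x \<in> ball 0 (1/2) \<and> t \<in> {-1/4<..<0} \<longrightarrow> norm (pgrad u x t) \<le> C * (M + \<epsilon>))"
proof -
  define c where "c = 2 * (4 + real DIM('a) + 8 * \<bar>p - 2\<bar>) / min 1 (p - 1)"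
  define A where "A = (8 * \<bar>p - 2\<bar> / min 1 (p - 1) + 1) * c"
  have m: "min 1 (p - 1) > 0"
    using assms by simp
  then have c: "c * min 1 (p - 1) = 2 * (4 + real DIM('a) + 8 * \<bar>p - 2\<bar>)"
    by (simp add: c_def)
  have "c > 0"
    unfolding c_def using m by (intro divide_pos_pos mult_pos_pos add_pos_nonneg) auto
  then have A: "A > 0"
    unfolding A_def using m by (intro mult_pos_pos add_nonneg_pos divide_nonneg_pos) auto
  show ?thesis
  \<comment> \<open>The square root of the constant 256 A in the estimate for the squared gradient;
    \<open>A\<close> depends only on p and the dimension.\<close>
  proof (intro exI[of _ "16 * sqrt A"] conjI allI impI)
    show "16 * sqrt A > 0"
      using A by simp
    fix \<epsilon> M :: real and u :: "'a \<Rightarrow> real \<Rightarrow> real" and x :: 'a and t :: real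
    let ?F = "\<lambda>z. u (fst z) (snd z)" and ?S = "ball (0::'a) 1 \<times> {-1<..<0::real}"
    assume \<epsilon>: "\<epsilon> > 0" and F: "smooth_on ?S ?F"
      and eq: "\<forall>x t. x \<in> ball 0 1 \<and> t \<in> {-1<..<0} \<longrightarrow>
       ptime u x t = (\<Sum>i\<in>Basis. \<Sum>j\<in>Basis. acoef p \<epsilon> (pgrad u x t) i j * pd2 u i j x t)"
      and M: "\<forall>x t. x \<in> ball 0 1 \<and> t \<in> {-1<..<0} \<longrightarrow> \<bar>u x t\<bar> \<le> M"
      and xt: "x \<in> ball 0 (1/2) \<and> t \<in> {-1/4<..<0}"
    have S: "open ?S"
      by (simp add: open_Times)
    have dF: "?F differentiable at (y, r)" if "y \<in> ball 0 1" "r \<in> {-1<..<0}" for y r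
      using smooth_on_differentiable[OF F S] that by simp
    have "p_heat_on p \<epsilon> ?S ?F"
      unfolding p_heat_on_def
    proof
      fix z assume "z \<in> ?S"
      then obtain y r where z: "z = (y, r)" and yr: "y \<in> ball 0 1" "r \<in> {-1<..<0}"
        by auto
      note D = sdir_eq_pgrad[OF dF[OF yr]]
      have H: "pd2 u i j y r = sdir i (sdir j ?F) (y, r)" for i j
        using pd2_eq_sdir[OF F _ _ yr] by simp
      have n: "(\<Sum>i\<in>Basis. (pgrad u y r \<bullet> i)\<^sup>2) = (norm (pgrad u y r))\<^sup>2"
        by (rule sum_inner_Basis_squares)
      have "tdir ?F (y, r) = ptime u y r"
        using deriv_slice[OF dF[OF yr]] by (simp add: ptime_def)
      also have "\<dots> = (\<Sum>i\<in>Basis. \<Sum>j\<in>Basis. acoef p \<epsilon> (pgrad u y r) i j * pd2 u i j y r)"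
        using eq yr by blast
      finally show "tdir ?F z = (\<Sum>i\<in>Basis. sdir i (sdir i ?F) z) +
        (p - 2) / ((\<Sum>i\<in>Basis. (sdir i ?F z)\<^sup>2) + \<epsilon>\<^sup>2) *
        (\<Sum>i\<in>Basis. \<Sum>j\<in>Basis. sdir i ?F z * sdir j ?F z * sdir i (sdir j ?F) z)"
        unfolding sum_acoef z D n H .
    qed
    moreover have "\<bar>?F z\<bar> \<le> M" if "z \<in> ?S" for z
      using M that by (cases z) simp
    ultimately have "(\<Sum>i\<in>Basis. (sdir i ?F (x, t))\<^sup>2) \<le> 256 * A * M\<^sup>2"
      unfolding A_def using xt by (intro p_heat_gradient_estimate[OF F _ assms \<epsilon> c]) auto
    moreover have "x \<in> ball 0 1" "t \<in> {-1<..<0}"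
      using xt by auto
    ultimately have "(norm (pgrad u x t))\<^sup>2 \<le> (16 * sqrt A * M)\<^sup>2"
      using A by (simp add: sdir_eq_pgrad[OF dF] sum_inner_Basis_squares power_mult_distrib)
    moreover have "0 \<le> M"
      using M \<open>x \<in> ball 0 1\<close> \<open>t \<in> {-1<..<0}\<close> order_trans[OF abs_ge_zero] by blast
    ultimately have "norm (pgrad u x t) \<le> 16 * sqrt A * M"
      using A by (auto intro: power2_le_imp_le)
    also have "\<dots> \<le> 16 * sqrt A * (M + \<epsilon>)"
      using A \<epsilon> by (intro mult_left_mono) auto
    finally show "norm (pgrad u x t) \<le> 16 * sqrt A * (M + \<epsilon>)" .
  qed
qed

end
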